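(* Let $X$ be a countable set, let $1\le p<\infty$, and let $T_t=\mathrm{e}^{Zt}$ ($t\ge 0$) be a positive one-parameter contraction semigroup acting on $l^p(X)$. Let $\mathcal{N}$ be the real subspace defined in the context. Then $T_t|_{\mathcal{N}}=I$ for all $t\geq 0$. In particular the peripheral point spectrum $P$ of $Z$ cannot contain any non-zero elements.
   Context: One-parameter semigroups are strongly continuous, with $T_0=I$, and $Z$ denotes the generator. Here $\mathcal{B}=l^p(X)=l^p_{\mathbf{C}}(X)$ is the space of complex-valued $p$-summable functions on $X$. Contraction means $\Vert T_t\Vert\le 1$ for all $t\ge0$. Positive means that $T_t$ commutes with complex conjugation and maps non-negative functions to non-negative functions. For $\theta\in\mathbf{R}$ put $\mathcal{L}_\theta=\{f\in\mathrm{Dom}(Z):Zf=i\theta f\}=\{f\in\mathcal{B}:T_tf=\mathrm{e}^{i\theta t}f\text{ for all }t\ge 0\}$. The peripheral point spectrum is $P=\{\theta\in\mathbf{R}:\mathcal{L}_\theta\ne\{0\}\}$. Let $\mathcal{L}$ be the closed linear span of $\bigcup\{\mathcal{L}_\theta:\theta\in P\}$. Fix a sequence $t(n)\to+\infty$ such that $\lim_{n\to\infty}\Vert T_{t(n)}f-f\Vert=0$ for all $f\in\mathcal{L}$ (such a sequence exists). Put $\mathcal{M}=\{f\in\mathcal{B}:\lim_{n\to\infty}\Vert T_{t(n)}f-f\Vert=0\}$, and let $\mathcal{N}$ be the set of real-valued elements of $\mathcal{M}$. *)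

theory Defs
  imports "HOL-Analysis.Infinite_Sum" "HOL-Library.Function_Algebras" "HOL-Library.Nonpos_Ints"
begin

text \<open>
  A function on \<open>X\<close> is represented by its extension by zero to the whole type, so that equality
  of functions on \<open>X\<close> is HOL equality. Addition, subtraction and zero of functions are the
  pointwise ones.
\<close>

definition lp :: "real \<Rightarrow> 'x set \<Rightarrow> ('x \<Rightarrow> complex) set" where
  "lp p X = {f. (\<forall>x. x \<notin> X \<longrightarrow> f x = 0) \<and> (\<lambda>x. norm (f x) powr p) summable_on X}"

definition lp_norm :: "real \<Rightarrow> 'x set \<Rightarrow> ('x \<Rightarrow> complex) \<Rightarrow> real" where
  "lp_norm p X f = (\<Sum>\<^sub>\<infinity>x\<in>X. norm (f x) powr p) powr (1 / p)"

definition cscale :: "complex \<Rightarrow> ('x \<Rightarrow> complex) \<Rightarrow> 'x \<Rightarrow> complex" where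
  "cscale c f = (\<lambda>x. c * f x)"

definition lp_tendsto ::
  "real \<Rightarrow> 'x set \<Rightarrow> ('i \<Rightarrow> 'x \<Rightarrow> complex) \<Rightarrow> ('x \<Rightarrow> complex) \<Rightarrow> 'i filter \<Rightarrow> bool" where
  "lp_tendsto p X F g L \<longleftrightarrow> ((\<lambda>i. lp_norm p X (F i - g)) \<longlongrightarrow> 0) L"

definition lp_bounded_linear ::
  "real \<Rightarrow> 'x set \<Rightarrow> (('x \<Rightarrow> complex) \<Rightarrow> 'x \<Rightarrow> complex) \<Rightarrow> bool" where
  "lp_bounded_linear p X A \<longleftrightarrow>
     (\<forall>f\<in>lp p X. A f \<in> lp p X) \<and>
     (\<forall>f\<in>lp p X. \<forall>g\<in>lp p X. A (f + g) = A f + A g) \<and>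
     (\<forall>c. \<forall>f\<in>lp p X. A (cscale c f) = cscale c (A f)) \<and>
     (\<exists>K. \<forall>f\<in>lp p X. lp_norm p X (A f) \<le> K * lp_norm p X f)"

definition lp_opnorm ::
  "real \<Rightarrow> 'x set \<Rightarrow> (('x \<Rightarrow> complex) \<Rightarrow> 'x \<Rightarrow> complex) \<Rightarrow> real" where
  "lp_opnorm p X A = (SUP f\<in>{f \<in> lp p X. lp_norm p X f \<le> 1}. lp_norm p X (A f))"

text \<open>Only the values \<open>T t f\<close> with \<open>t \<ge> 0\<close> and \<open>f\<close> in \<open>lp p X\<close> are constrained.\<close>

definition one_param_semigroup ::
  "real \<Rightarrow> 'x set \<Rightarrow> (real \<Rightarrow> ('x \<Rightarrow> complex) \<Rightarrow> 'x \<Rightarrow> complex) \<Rightarrow> bool" where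
  "one_param_semigroup p X T \<longleftrightarrow>
     (\<forall>t\<ge>0. lp_bounded_linear p X (T t)) \<and>
     (\<forall>f\<in>lp p X. T 0 f = f) \<and>
     (\<forall>s\<ge>0. \<forall>t\<ge>0. \<forall>f\<in>lp p X. T (s + t) f = T s (T t f)) \<and>
     (\<forall>f\<in>lp p X. \<forall>t\<ge>0. lp_tendsto p X (\<lambda>s. T s f) (T t f) (at t within {0..}))"

definition contraction_semigroup ::
  "real \<Rightarrow> 'x set \<Rightarrow> (real \<Rightarrow> ('x \<Rightarrow> complex) \<Rightarrow> 'x \<Rightarrow> complex) \<Rightarrow> bool" where
  "contraction_semigroup p X T \<longleftrightarrow>
     one_param_semigroup p X T \<and> (\<forall>t\<ge>0. lp_opnorm p X (T t) \<le> 1)"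

definition lp_positive ::
  "real \<Rightarrow> 'x set \<Rightarrow> (('x \<Rightarrow> complex) \<Rightarrow> 'x \<Rightarrow> complex) \<Rightarrow> bool" where
  "lp_positive p X A \<longleftrightarrow>
     (\<forall>f\<in>lp p X. A (\<lambda>x. cnj (f x)) = (\<lambda>x. cnj (A f x))) \<and>
     (\<forall>f\<in>lp p X. (\<forall>x\<in>X. f x \<in> \<real>\<^sub>\<ge>\<^sub>0) \<longrightarrow> (\<forall>x\<in>X. A f x \<in> \<real>\<^sub>\<ge>\<^sub>0))"

definition generator_dom ::
  "real \<Rightarrow> 'x set \<Rightarrow> (real \<Rightarrow> ('x \<Rightarrow> complex) \<Rightarrow> 'x \<Rightarrow> complex) \<Rightarrow> ('x \<Rightarrow> complex) set" where
  "generator_dom p X T =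
     {f \<in> lp p X. \<exists>g\<in>lp p X.
        lp_tendsto p X (\<lambda>h. cscale (of_real (1 / h)) (T h f - f)) g (at_right 0)}"

definition generator ::
  "real \<Rightarrow> 'x set \<Rightarrow> (real \<Rightarrow> ('x \<Rightarrow> complex) \<Rightarrow> 'x \<Rightarrow> complex) \<Rightarrow> ('x \<Rightarrow> complex) \<Rightarrow> 'x \<Rightarrow> complex" where
  "generator p X T f =
     (THE g. g \<in> lp p X \<and>
        lp_tendsto p X (\<lambda>h. cscale (of_real (1 / h)) (T h f - f)) g (at_right 0))"

definition peripheral_eigenspace ::
  "real \<Rightarrow> 'x set \<Rightarrow> (real \<Rightarrow> ('x \<Rightarrow> complex) \<Rightarrow> 'x \<Rightarrow> complex) \<Rightarrow> real \<Rightarrow> ('x \<Rightarrow> complex) set" where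
  "peripheral_eigenspace p X T \<theta> =
     {f \<in> generator_dom p X T. generator p X T f = cscale (\<i> * of_real \<theta>) f}"

definition peripheral_point_spectrum ::
  "real \<Rightarrow> 'x set \<Rightarrow> (real \<Rightarrow> ('x \<Rightarrow> complex) \<Rightarrow> 'x \<Rightarrow> complex) \<Rightarrow> real set" where
  "peripheral_point_spectrum p X T = {\<theta>. peripheral_eigenspace p X T \<theta> \<noteq> {0}}"

definition lp_closure :: "real \<Rightarrow> 'x set \<Rightarrow> ('x \<Rightarrow> complex) set \<Rightarrow> ('x \<Rightarrow> complex) set" where
  "lp_closure p X S = {f \<in> lp p X. \<forall>\<epsilon>>0. \<exists>g\<in>S. lp_norm p X (f - g) < \<epsilon>}"

definition peripheral_span ::
  "real \<Rightarrow> 'x set \<Rightarrow> (real \<Rightarrow> ('x \<Rightarrow> complex) \<Rightarrow> 'x \<Rightarrow> complex) \<Rightarrow> ('x \<Rightarrow> complex) set" where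
  "peripheral_span p X T =
     lp_closure p X
       (module.span cscale
         (\<Union>\<theta>\<in>peripheral_point_spectrum p X T. peripheral_eigenspace p X T \<theta>))"

definition recurrent_subspace ::
  "real \<Rightarrow> 'x set \<Rightarrow> (real \<Rightarrow> ('x \<Rightarrow> complex) \<Rightarrow> 'x \<Rightarrow> complex) \<Rightarrow> (nat \<Rightarrow> real) \<Rightarrow> ('x \<Rightarrow> complex) set" where
  "recurrent_subspace p X T \<tau> =
     {f \<in> lp p X. lp_tendsto p X (\<lambda>n. T (\<tau> n) f) f sequentially}"

definition real_recurrent_subspace ::
  "real \<Rightarrow> 'x set \<Rightarrow> (real \<Rightarrow> ('x \<Rightarrow> complex) \<Rightarrow> 'x \<Rightarrow> complex) \<Rightarrow> (nat \<Rightarrow> real) \<Rightarrow> ('x \<Rightarrow> complex) set" where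
  "real_recurrent_subspace p X T \<tau> = {f \<in> recurrent_subspace p X T \<tau>. \<forall>x\<in>X. f x \<in> \<real>}"

text \<open>\<open>module.span\<close> is only meaningful for a scalar action satisfying the module laws.\<close>

lemma module_cscale: "module (cscale :: complex \<Rightarrow> ('x \<Rightarrow> complex) \<Rightarrow> 'x \<Rightarrow> complex)"
  by unfold_locales (auto simp: cscale_def fun_eq_iff algebra_simps)

end

theory Submission
  imports Defs
begin

text \<open>
  Let \<open>R\<close> be the set of real \<open>u\<close> with \<open>T (\<tau> n) u \<longlonglongrightarrow> u\<close>. Since \<open>\<tau> n \<rightarrow> \<infinity>\<close>, every \<open>T t\<close> is isometric
  on \<open>R\<close>. As \<open>\<bar>T t u\<bar> \<le> T t \<bar>u\<bar>\<close> and \<open>0 \<le> h \<le> g\<close>, \<open>\<parallel>g\<parallel> \<le> \<parallel>h\<parallel>\<close> force \<open>g = h\<close>, it is even a lattice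
  homomorphism on \<open>R\<close>, and \<open>R\<close> is a closed sublattice. If some \<open>u \<in> R\<close> does not vanish at \<open>x\<close>,
  there is a least non-negative \<open>e \<in> R\<close> with \<open>e x = 1\<close>, and then \<open>f \<ge> f x \<cdot> e\<close> for all non-negative
  \<open>f \<in> R\<close>. In particular \<open>T s e = c s \<cdot> e + r\<close> with \<open>r\<close> disjoint from \<open>e\<close>, so that \<open>T s' e\<close> and
  \<open>T s' r\<close> are disjoint for all \<open>s'\<close>. For \<open>s' = \<tau> n - s\<close> and small \<open>s\<close> the former is positive at
  \<open>x\<close>, hence \<open>c (\<tau> n) = c s \<cdot> c s' \<le> c s\<close>, and \<open>n \<rightarrow> \<infinity>\<close> gives \<open>c s = 1\<close>. So \<open>T\<close> fixes every such
  \<open>e\<close>; thus \<open>T t f \<ge> f\<close> for non-negative \<open>f \<in> R\<close>, with equality because the norms agree.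
  For an eigenvalue \<open>\<theta> \<noteq> 0\<close> one applies this with \<open>\<tau> n = 2 \<pi> n / \<bar>\<theta>\<bar>\<close> to the real and imaginary parts
  of an eigenvector.
\<close>

section \<open>Powers of \<open>l\<^sup>p\<close> norms\<close>

text \<open>Working with the \<open>p\<close>-th power of the norm avoids Minkowski's inequality: the bound
  \<open>\<bar>a + b\<bar>\<^sup>p \<le> 2\<^sup>p (\<bar>a\<bar>\<^sup>p + \<bar>b\<bar>\<^sup>p)\<close> and superadditivity on non-negative functions suffice.\<close>

definition ell :: "real \<Rightarrow> 'x set \<Rightarrow> ('x \<Rightarrow> 'a::real_normed_vector) set" where
  "ell p X = {f. (\<forall>x. x \<notin> X \<longrightarrow> f x = 0) \<and> (\<lambda>x. norm (f x) powr p) summable_on X}"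

definition psum :: "real \<Rightarrow> 'x set \<Rightarrow> ('x \<Rightarrow> 'a::real_normed_vector) \<Rightarrow> real" where
  "psum p X f = (\<Sum>\<^sub>\<infinity>x\<in>X. norm (f x) powr p)"

text \<open>Split one factor off each power: \<open>c powr p = c * c powr (p - 1)\<close>, and the
  remaining factor grows with \<open>c\<close> because \<open>p - 1\<close> is non-negative.\<close>

lemma powr_superadditive:
  fixes a b p :: real
  assumes "0 \<le> a" "0 \<le> b" "1 \<le> p"
  shows "a powr p + b powr p \<le> (a + b) powr p"
proof -
  have *: "c powr p = c * c powr (p - 1)" if "0 \<le> c" for c :: real
    using that by (cases "c = 0") (auto simp: powr_diff)
  have "a powr p + b powr p = a * a powr (p - 1) + b * b powr (p - 1)"
    using assms * by simp
  also have "\<dots> \<le> a * (a + b) powr (p - 1) + b * (a + b) powr (p - 1)"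
    using assms by (intro add_mono mult_left_mono powr_mono2) auto
  also have "\<dots> = (a + b) powr p"
    using assms *[of "a + b"] by (simp add: algebra_simps)
  finally show ?thesis .
qed

lemma powr_quasi_subadditive:
  fixes a b p :: real
  assumes "0 \<le> a" "0 \<le> b" "0 \<le> p"
  shows "(a + b) powr p \<le> 2 powr p * (a powr p + b powr p)"
proof -
  have "(a + b) powr p \<le> (2 * max a b) powr p"
    using assms by (intro powr_mono2) auto
  also have "\<dots> = 2 powr p * max a b powr p"
    using assms by (simp add: powr_mult)
  also have "\<dots> \<le> 2 powr p * (a powr p + b powr p)"
    by (intro mult_left_mono) (auto simp: max_def)
  finally show ?thesis .
qed

lemma psum_nonneg: "0 \<le> psum p X f"
  unfolding psum_def by (rule infsum_nonneg) simp

text \<open>For non-negative terms a uniform bound on finite partial sums already yields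
  summability. The domination lemmas and Fatou's lemma are therefore argued on finite sums.\<close>

lemma ell_bound:
  fixes f :: "'x \<Rightarrow> 'a::real_normed_vector"
  assumes "\<And>x. x \<notin> X \<Longrightarrow> f x = 0"
    and "\<And>F. finite F \<Longrightarrow> F \<subseteq> X \<Longrightarrow> (\<Sum>x\<in>F. norm (f x) powr p) \<le> K"
  shows "f \<in> ell p X" and "psum p X f \<le> K"
proof -
  have *: "(\<lambda>x. norm (f x) powr p) summable_on X"
    by (rule nonneg_bdd_above_summable_on) (auto intro!: bdd_aboveI[of _ K] assms(2))
  then show "f \<in> ell p X"
    using assms(1) by (auto simp: ell_def)
  show "psum p X f \<le> K"
    unfolding psum_def using * by (rule infsum_le_finite_sums) (use assms(2) in auto)
qed

lemma finite_sum_le_psum: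
  assumes "f \<in> ell p X" "finite F" "F \<subseteq> X"
  shows "(\<Sum>x\<in>F. norm (f x) powr p) \<le> psum p X f"
  using assms unfolding psum_def ell_def by (auto intro: finite_sum_le_infsum)

lemma norm_powr_le_psum:
  assumes "f \<in> ell p X"
  shows "norm (f x) powr p \<le> psum p X f"
proof (cases "x \<in> X")
  case True
  then show ?thesis using finite_sum_le_psum[OF assms, of "{x}"] by simp
next
  case False
  then show ?thesis using assms by (auto simp: ell_def psum_nonneg)
qed

lemma ell_outside: "f \<in> ell p X \<Longrightarrow> x \<notin> X \<Longrightarrow> f x = 0"
  by (simp add: ell_def)

lemma ell_dominated:
  fixes f :: "'x \<Rightarrow> 'a::real_normed_vector" and g :: "'x \<Rightarrow> 'b::real_normed_vector"
  assumes "f \<in> ell p X" "0 \<le> p" "\<And>x. norm (g x) \<le> norm (f x)"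
  shows "g \<in> ell p X" and "psum p X g \<le> psum p X f"
proof -
  have 1: "g x = 0" if "x \<notin> X" for x
    using assms(3)[of x] ell_outside[OF assms(1) that] by simp
  have 2: "(\<Sum>x\<in>F. norm (g x) powr p) \<le> psum p X f" if "finite F" "F \<subseteq> X" for F
  proof -
    have "(\<Sum>x\<in>F. norm (g x) powr p) \<le> (\<Sum>x\<in>F. norm (f x) powr p)"
      using assms by (intro sum_mono powr_mono2) auto
    also have "\<dots> \<le> psum p X f"
      using finite_sum_le_psum assms that by blast
    finally show ?thesis .
  qed
  show "g \<in> ell p X" "psum p X g \<le> psum p X f"
    using ell_bound[of X g p "psum p X f", OF 1 2] by auto
qed

lemma ell_dominated_add:
  fixes f g :: "'x \<Rightarrow> 'a::real_normed_vector" and h :: "'x \<Rightarrow> 'b::real_normed_vector"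
  assumes "f \<in> ell p X" "g \<in> ell p X" "0 \<le> p" "\<And>x. norm (h x) \<le> norm (f x) + norm (g x)"
  shows "h \<in> ell p X" and "psum p X h \<le> 2 powr p * (psum p X f + psum p X g)"
proof -
  have 1: "h x = 0" if "x \<notin> X" for x
    using assms(4)[of x] ell_outside[OF assms(1) that] ell_outside[OF assms(2) that] by simp
  have 2: "(\<Sum>x\<in>F. norm (h x) powr p) \<le> 2 powr p * (psum p X f + psum p X g)"
    if F: "finite F" "F \<subseteq> X" for F
  proof -
    have "(\<Sum>x\<in>F. norm (h x) powr p) \<le> (\<Sum>x\<in>F. (norm (f x) + norm (g x)) powr p)"
      using assms by (intro sum_mono powr_mono2) auto
    also have "\<dots> \<le> (\<Sum>x\<in>F. 2 powr p * (norm (f x) powr p + norm (g x) powr p))"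
      using assms by (intro sum_mono powr_quasi_subadditive) auto
    also have "\<dots> = 2 powr p * ((\<Sum>x\<in>F. norm (f x) powr p) + (\<Sum>x\<in>F. norm (g x) powr p))"
      by (simp add: sum_distrib_left sum.distrib algebra_simps)
    also have "\<dots> \<le> 2 powr p * (psum p X f + psum p X g)"
      using finite_sum_le_psum[OF assms(1) F] finite_sum_le_psum[OF assms(2) F]
      by (intro mult_left_mono add_mono) auto
    finally show ?thesis .
  qed
  show "h \<in> ell p X" "psum p X h \<le> 2 powr p * (psum p X f + psum p X g)"
    using ell_bound[of X h p, OF 1 2] by auto
qed

lemma psum_scaled:
  fixes f :: "'x \<Rightarrow> 'a::real_normed_vector" and g :: "'x \<Rightarrow> 'b::real_normed_vector"
  assumes "f \<in> ell p X" "0 \<le> c" "\<And>x. norm (g x) = c * norm (f x)"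
  shows "g \<in> ell p X" and "psum p X g = c powr p * psum p X f"
proof -
  have *: "(\<lambda>x. norm (g x) powr p) = (\<lambda>x. c powr p * norm (f x) powr p)"
    using assms by (simp add: powr_mult)
  show "psum p X g = c powr p * psum p X f"
    unfolding psum_def * by (rule infsum_cmult_right')
  have "g x = 0" if "x \<notin> X" for x
    using assms(3)[of x] ell_outside[OF assms(1) that] by simp
  moreover have "(\<lambda>x. norm (g x) powr p) summable_on X"
    unfolding * using assms(1) by (auto simp: ell_def intro: summable_on_cmult_right)
  ultimately show "g \<in> ell p X"
    by (simp add: ell_def)
qed

lemma ell_add: "f \<in> ell p X \<Longrightarrow> g \<in> ell p X \<Longrightarrow> 0 \<le> p \<Longrightarrow> f + g \<in> ell p X"
  by (rule ell_dominated_add(1)[of f p X g]) (auto simp: norm_triangle_ineq)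

lemma ell_diff: "f \<in> ell p X \<Longrightarrow> g \<in> ell p X \<Longrightarrow> 0 \<le> p \<Longrightarrow> f - g \<in> ell p X"
  by (rule ell_dominated_add(1)[of f p X g]) (auto simp: norm_triangle_ineq4)

lemma psum_add_le:
  "f \<in> ell p X \<Longrightarrow> g \<in> ell p X \<Longrightarrow> 0 \<le> p \<Longrightarrow>
    psum p X (f + g) \<le> 2 powr p * (psum p X f + psum p X g)"
  by (rule ell_dominated_add(2)) (auto intro: norm_triangle_ineq)

lemma psum_zero [simp]: "psum p X 0 = 0"
  by (simp add: psum_def)

lemma psum_le_0_imp_zero:
  assumes "f \<in> ell p X" "psum p X f \<le> 0"
  shows "f = 0"
proof
  fix x
  show "f x = 0 x"
    using norm_powr_le_psum[OF assms(1), of x] assms(2)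
    by (auto simp: dest: antisym[OF order_trans, OF _ _ powr_ge_zero])
qed

lemma powr_tendsto_0_iff:
  fixes F :: "'i \<Rightarrow> real"
  assumes "0 < p" "\<And>i. 0 \<le> F i"
  shows "((\<lambda>i. F i powr p) \<longlongrightarrow> 0) L \<longleftrightarrow> (F \<longlongrightarrow> 0) L"
proof
  assume "((\<lambda>i. F i powr p) \<longlongrightarrow> 0) L"
  then have "((\<lambda>i. (F i powr p) powr (1 / p)) \<longlongrightarrow> 0 powr (1 / p)) L"
    using assms by (intro tendsto_powr') auto
  then show "(F \<longlongrightarrow> 0) L"
    using assms by (simp add: powr_powr)
next
  assume "(F \<longlongrightarrow> 0) L"
  then have "((\<lambda>i. F i powr p) \<longlongrightarrow> 0 powr p) L"
    using assms by (intro tendsto_powr') auto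
  then show "((\<lambda>i. F i powr p) \<longlongrightarrow> 0) L" by simp
qed

lemma psum_tendsto_pointwise:
  assumes "((\<lambda>i. psum p X (F i - f)) \<longlongrightarrow> 0) L" "eventually (\<lambda>i. F i - f \<in> ell p X) L" "0 < p"
  shows "((\<lambda>i. F i x) \<longlongrightarrow> f x) L"
proof -
  have "((\<lambda>i. norm ((F i - f) x) powr p) \<longlongrightarrow> 0) L"
    by (rule tendsto_sandwich[OF _ eventually_mono[OF assms(2) norm_powr_le_psum] tendsto_const assms(1)])
      simp
  then have "((\<lambda>i. norm (F i x - f x)) \<longlongrightarrow> 0) L"
    using assms(3) by (simp add: powr_tendsto_0_iff)
  then show ?thesis
    by (simp add: LIM_zero_iff tendsto_norm_zero_iff)
qed

text \<open>Finite sums pass to the pointwise limit, and the bound \<open>K\<close> is uniform over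
  finite sets.\<close>

lemma psum_Fatou:
  fixes F :: "nat \<Rightarrow> 'x \<Rightarrow> 'a::real_normed_vector"
  assumes "\<And>x. (\<lambda>n. F n x) \<longlonglongrightarrow> f x" "eventually (\<lambda>n. F n \<in> ell p X \<and> psum p X (F n) \<le> K) sequentially"
    and "0 < p"
  shows "f \<in> ell p X" and "psum p X f \<le> K"
proof -
  have 1: "f x = 0" if "x \<notin> X" for x
  proof (rule LIMSEQ_unique[OF assms(1)])
    show "(\<lambda>n. F n x) \<longlonglongrightarrow> 0"
      using assms(2) that
      by (intro tendsto_eventually) (auto elim!: eventually_mono simp: ell_outside)
  qed
  have 2: "(\<Sum>x\<in>A. norm (f x) powr p) \<le> K" if A: "finite A" "A \<subseteq> X" for A
  proof (rule tendsto_upperbound)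
    show "(\<lambda>n. \<Sum>x\<in>A. norm (F n x) powr p) \<longlonglongrightarrow> (\<Sum>x\<in>A. norm (f x) powr p)"
      using assms(3) by (intro tendsto_sum tendsto_powr' tendsto_norm assms(1)) auto
    show "\<forall>\<^sub>F n in sequentially. (\<Sum>x\<in>A. norm (F n x) powr p) \<le> K"
      using assms(2) by eventually_elim (use finite_sum_le_psum A in \<open>blast intro: order_trans\<close>)
  qed simp
  show "f \<in> ell p X" "psum p X f \<le> K"
    using ell_bound[of X f p, OF 1 2] by auto
qed

text \<open>Apply \<open>powr_superadditive\<close> at each point to \<open>g = (g - h) + h\<close>.
  The distance between comparable functions is thus bounded by the drop in their sums.\<close>

lemma psum_superadditive:
  fixes g h :: "'x \<Rightarrow> real"
  assumes "g \<in> ell p X" "1 \<le> p" "\<And>x. 0 \<le> h x" "\<And>x. h x \<le> g x"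
  shows "psum p X (g - h) + psum p X h \<le> psum p X g"
proof -
  have h: "h \<in> ell p X"
    by (rule ell_dominated(1)[OF assms(1)]) (use assms in \<open>auto intro: order_trans[OF _ abs_ge_self]\<close>)
  have gh: "g - h \<in> ell p X"
    using assms(1,2) h by (simp add: ell_diff)
  have "psum p X (g - h) + psum p X h = (\<Sum>\<^sub>\<infinity>x\<in>X. norm ((g - h) x) powr p + norm (h x) powr p)"
    unfolding psum_def using h gh by (intro infsum_add[symmetric]) (auto simp: ell_def)
  also have "\<dots> \<le> psum p X g"
    unfolding psum_def
  proof (rule infsum_mono)
    show "(\<lambda>x. norm ((g - h) x) powr p + norm (h x) powr p) summable_on X"
      using h gh by (intro summable_on_add) (auto simp: ell_def)
    show "(\<lambda>x. norm (g x) powr p) summable_on X"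
      using assms by (auto simp: ell_def)
    show "norm ((g - h) x) powr p + norm (h x) powr p \<le> norm (g x) powr p" for x
      using powr_superadditive[of "g x - h x" "h x" p] assms(2) assms(3,4)[of x] by auto
  qed
  finally show ?thesis .
qed

text \<open>Strict monotonicity of the norm on the non-negative cone. This is how comparisons of
  norms become equalities of functions below.\<close>

lemma eq_if_psum_ge:
  fixes g h :: "'x \<Rightarrow> real"
  assumes "g \<in> ell p X" "1 \<le> p" "\<And>x. 0 \<le> h x" "\<And>x. h x \<le> g x" "psum p X g \<le> psum p X h"
  shows "g = h"
proof -
  have "h \<in> ell p X"
    by (rule ell_dominated(1)[OF assms(1)]) (use assms in \<open>auto intro: order_trans[OF _ abs_ge_self]\<close>)
  then have "g - h \<in> ell p X"
    using assms(1,2) by (simp add: ell_diff)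
  then have "g - h = 0"
    using psum_superadditive[OF assms(1-4)] assms(5) by (intro psum_le_0_imp_zero) auto
  then show ?thesis by simp
qed

section \<open>Recurrent vectors of a positive real semigroup\<close>

locale real_lp_semigroup =
  fixes X :: "'x set" and p :: real and S :: "real \<Rightarrow> ('x \<Rightarrow> real) \<Rightarrow> 'x \<Rightarrow> real"
  assumes p_ge_1: "1 \<le> p"
    and S_ell: "0 \<le> t \<Longrightarrow> u \<in> ell p X \<Longrightarrow> S t u \<in> ell p X"
    and S_add: "0 \<le> t \<Longrightarrow> u \<in> ell p X \<Longrightarrow> v \<in> ell p X \<Longrightarrow> S t (u + v) = S t u + S t v"
    and S_scale: "0 \<le> t \<Longrightarrow> u \<in> ell p X \<Longrightarrow> S t (\<lambda>x. c * u x) = (\<lambda>x. c * S t u x)"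
    and S_semigroup: "0 \<le> s \<Longrightarrow> 0 \<le> t \<Longrightarrow> u \<in> ell p X \<Longrightarrow> S (s + t) u = S s (S t u)"
    and S_nonneg: "0 \<le> t \<Longrightarrow> u \<in> ell p X \<Longrightarrow> (\<And>x. 0 \<le> u x) \<Longrightarrow> 0 \<le> S t u x"
    and S_contraction: "0 \<le> t \<Longrightarrow> u \<in> ell p X \<Longrightarrow> psum p X (S t u) \<le> psum p X u"
    and S_continuous: "u \<in> ell p X \<Longrightarrow> ((\<lambda>t. psum p X (S t u - u)) \<longlongrightarrow> 0) (at_right 0)"
begin

lemma p_pos: "0 < p" and p_nonneg: "0 \<le> p"
  using p_ge_1 by auto

lemma add_ell: "u \<in> ell p X \<Longrightarrow> v \<in> ell p X \<Longrightarrow> u + v \<in> ell p X" for u v :: "'x \<Rightarrow> real"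
  by (simp add: ell_add p_nonneg)

lemma diff_ell: "u \<in> ell p X \<Longrightarrow> v \<in> ell p X \<Longrightarrow> u - v \<in> ell p X" for u v :: "'x \<Rightarrow> real"
  by (simp add: ell_diff p_nonneg)

lemma scale_ell: "u \<in> ell p X \<Longrightarrow> (\<lambda>x. c * u x) \<in> ell p X" for u :: "'x \<Rightarrow> real"
  by (rule psum_scaled(1)[where c = "\<bar>c\<bar>"]) (auto simp: abs_mult)

lemma abs_ell: "u \<in> ell p X \<Longrightarrow> (\<lambda>x. \<bar>u x\<bar>) \<in> ell p X" for u :: "'x \<Rightarrow> real"
  by (rule ell_dominated(1)) (auto simp: p_nonneg)

lemma S_diff:
  assumes "0 \<le> t" "u \<in> ell p X" "v \<in> ell p X"
  shows "S t (u - v) = S t u - S t v"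
proof -
  have "S t u = S t ((u - v) + v)" by simp
  also have "\<dots> = S t (u - v) + S t v"
    using assms by (intro S_add diff_ell) auto
  finally show ?thesis by simp
qed

lemma S_mono:
  assumes "0 \<le> t" "u \<in> ell p X" "v \<in> ell p X" "\<And>x. u x \<le> v x"
  shows "S t u x \<le> S t v x"
  using S_nonneg[of t "v - u" x] assms by (simp add: diff_ell S_diff)

lemma abs_S_le:
  assumes "0 \<le> t" "u \<in> ell p X"
  shows "\<bar>S t u x\<bar> \<le> S t (\<lambda>x. \<bar>u x\<bar>) x"
proof -
  have "S t (\<lambda>x. - 1 * u x) x \<le> S t (\<lambda>x. \<bar>u x\<bar>) x"
    using assms by (intro S_mono scale_ell abs_ell) auto
  moreover have "S t u x \<le> S t (\<lambda>x. \<bar>u x\<bar>) x"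
    using assms by (intro S_mono abs_ell) auto
  ultimately show ?thesis
    unfolding S_scale[OF assms] by linarith
qed

end

section \<open>The closed sublattice of recurrent vectors\<close>

locale real_lp_recurrence = real_lp_semigroup +
  fixes \<tau> :: "nat \<Rightarrow> real"
  assumes \<tau>: "filterlim \<tau> at_top sequentially"
begin

definition R :: "('a \<Rightarrow> real) set" where
  "R = {u \<in> ell p X. (\<lambda>n. psum p X (S (\<tau> n) u - u)) \<longlonglongrightarrow> 0}"

lemma R_ell: "u \<in> R \<Longrightarrow> u \<in> ell p X"
  by (simp add: R_def)

lemma \<tau>_ge: "eventually (\<lambda>n. t \<le> \<tau> n) sequentially"
  using \<tau> by (simp add: filterlim_at_top)

lemma RI:
  assumes "u \<in> ell p X" "eventually (\<lambda>n. psum p X (S (\<tau> n) u - u) \<le> G n) sequentially" "G \<longlonglongrightarrow> 0"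
  shows "u \<in> R"
proof -
  have "(\<lambda>n. psum p X (S (\<tau> n) u - u)) \<longlonglongrightarrow> 0"
    by (rule tendsto_sandwich[OF _ assms(2) tendsto_const assms(3)]) (simp add: psum_nonneg)
  then show ?thesis using assms(1) by (simp add: R_def)
qed

lemma R_add:
  assumes "u \<in> R" "v \<in> R"
  shows "u + v \<in> R"
proof (rule RI)
  show "(\<lambda>n. 2 powr p * (psum p X (S (\<tau> n) u - u) + psum p X (S (\<tau> n) v - v))) \<longlonglongrightarrow> 0"
    using assms by (intro tendsto_mult_right_zero tendsto_add_zero) (auto simp: R_def)
  show "\<forall>\<^sub>F n in sequentially. psum p X (S (\<tau> n) (u + v) - (u + v)) \<le>
      2 powr p * (psum p X (S (\<tau> n) u - u) + psum p X (S (\<tau> n) v - v))"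
    using \<tau>_ge[of 0]
  proof eventually_elim
    case (elim n)
    have *: "S (\<tau> n) (u + v) - (u + v) = (S (\<tau> n) u - u) + (S (\<tau> n) v - v)"
      using elim assms by (simp add: S_add R_ell)
    show ?case
      unfolding * using elim assms by (intro psum_add_le diff_ell S_ell R_ell p_nonneg)
  qed
qed (use assms in \<open>auto intro: add_ell R_ell\<close>)

lemma R_scale:
  assumes "u \<in> R"
  shows "(\<lambda>x. c * u x) \<in> R"
proof (rule RI)
  show "(\<lambda>n. \<bar>c\<bar> powr p * psum p X (S (\<tau> n) u - u)) \<longlonglongrightarrow> 0"
    using assms by (intro tendsto_mult_right_zero) (auto simp: R_def)
  show "\<forall>\<^sub>F n in sequentially. psum p X (S (\<tau> n) (\<lambda>x. c * u x) - (\<lambda>x. c * u x)) \<le>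
      \<bar>c\<bar> powr p * psum p X (S (\<tau> n) u - u)"
    using \<tau>_ge[of 0]
  proof eventually_elim
    case (elim n)
    show ?case
      using elim assms
      by (intro psum_scaled(2)[THEN eq_refl] diff_ell S_ell R_ell)
        (auto simp: S_scale R_ell abs_mult simp flip: right_diff_distrib)
  qed
qed (use assms in \<open>auto intro: scale_ell R_ell\<close>)

lemma R_diff:
  assumes "u \<in> R" "v \<in> R"
  shows "u - v \<in> R"
  using R_add[OF assms(1) R_scale[OF assms(2), of "-1"]]
  by (simp add: plus_fun_def fun_diff_def)

text \<open>Once \<open>\<tau> n \<ge> 0\<close>, \<open>S t\<close> commutes with
  \<open>S (\<tau> n)\<close>, so the error for \<open>S t u\<close> is the image of the error for
  \<open>u\<close> under a contraction.\<close>

lemma R_S: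
  assumes "u \<in> R" "0 \<le> t"
  shows "S t u \<in> R"
proof (rule RI)
  show "\<forall>\<^sub>F n in sequentially. psum p X (S (\<tau> n) (S t u) - S t u) \<le> psum p X (S (\<tau> n) u - u)"
    using \<tau>_ge[of 0]
  proof eventually_elim
    case (elim n)
    have "S (\<tau> n) (S t u) = S t (S (\<tau> n) u)"
      using elim assms S_semigroup[of "\<tau> n" t u] S_semigroup[of t "\<tau> n" u]
      by (simp add: R_ell add.commute)
    then have "S (\<tau> n) (S t u) - S t u = S t (S (\<tau> n) u - u)"
      using elim assms by (simp add: S_diff R_ell S_ell)
    then show ?case
      using elim assms by (simp add: S_contraction diff_ell S_ell R_ell)
  qed
  show "(\<lambda>n. psum p X (S (\<tau> n) u - u)) \<longlonglongrightarrow> 0"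
    using assms by (simp add: R_def)
qed (use assms in \<open>auto intro: S_ell R_ell\<close>)

lemma R_pointwise:
  assumes "u \<in> R"
  shows "(\<lambda>n. S (\<tau> n) u x) \<longlonglongrightarrow> u x"
proof (rule psum_tendsto_pointwise[where X = X and p = p])
  show "(\<lambda>n. psum p X (S (\<tau> n) u - u)) \<longlonglongrightarrow> 0"
    using assms by (simp add: R_def)
  show "\<forall>\<^sub>F n in sequentially. S (\<tau> n) u - u \<in> ell p X"
    using \<tau>_ge[of 0] by eventually_elim (use assms in \<open>auto intro: diff_ell S_ell R_ell\<close>)
qed (rule p_pos)

text \<open>Once \<open>\<tau> n \<ge> t\<close>, \<open>S (\<tau> n) u\<close> is the image of
  \<open>S t u\<close> under a contraction and so has no larger norm; Fatou carries this bound to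
  the limit \<open>u\<close>.\<close>

lemma R_psum:
  assumes "u \<in> R" "0 \<le> t"
  shows "psum p X (S t u) = psum p X u"
proof (rule antisym)
  show "psum p X (S t u) \<le> psum p X u"
    using assms by (simp add: S_contraction R_ell)
  show "psum p X u \<le> psum p X (S t u)"
  proof (rule psum_Fatou(2)[OF R_pointwise[OF assms(1)] _ p_pos])
    show "\<forall>\<^sub>F n in sequentially. S (\<tau> n) u \<in> ell p X \<and> psum p X (S (\<tau> n) u) \<le> psum p X (S t u)"
      using \<tau>_ge[of t]
    proof eventually_elim
      case (elim n)
      have "S (\<tau> n) u = S (\<tau> n - t) (S t u)"
        using S_semigroup[of "\<tau> n - t" t u] elim assms by (simp add: R_ell)
      then show ?case
        using elim S_ell[OF assms(2) R_ell[OF assms(1)]] by (auto intro!: S_contraction S_ell)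
    qed
  qed
qed

text \<open>\<open>\<bar>S t u\<bar>\<close> lies below \<open>S t \<bar>u\<bar>\<close>, while
  contraction and \<open>R_psum\<close> for \<open>u\<close> bound the sum of the larger function by
  that of the smaller one.\<close>

lemma S_abs:
  assumes "u \<in> R" "0 \<le> t"
  shows "S t (\<lambda>x. \<bar>u x\<bar>) = (\<lambda>x. \<bar>S t u x\<bar>)"
proof (rule eq_if_psum_ge[where X = X and p = p])
  have "psum p X (S t (\<lambda>x. \<bar>u x\<bar>)) \<le> psum p X (\<lambda>x. \<bar>u x\<bar>)"
    using assms by (simp add: S_contraction abs_ell R_ell)
  also have "\<dots> = psum p X (S t u)"
    using R_psum[OF assms] by (simp add: psum_def)
  also have "\<dots> = psum p X (\<lambda>x. \<bar>S t u x\<bar>)"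
    by (simp add: psum_def)
  finally show "psum p X (S t (\<lambda>x. \<bar>u x\<bar>)) \<le> psum p X (\<lambda>x. \<bar>S t u x\<bar>)" .
qed (use assms in \<open>auto intro: S_ell abs_ell R_ell p_ge_1 abs_S_le\<close>)

text \<open>By \<open>S_abs\<close> the error for \<open>\<bar>u\<bar>\<close> is a difference of
  absolute values, at each point at most the error for \<open>u\<close> in modulus.\<close>

lemma R_abs:
  assumes "u \<in> R"
  shows "(\<lambda>x. \<bar>u x\<bar>) \<in> R"
proof (rule RI)
  show "\<forall>\<^sub>F n in sequentially. psum p X (S (\<tau> n) (\<lambda>x. \<bar>u x\<bar>) - (\<lambda>x. \<bar>u x\<bar>)) \<le> psum p X (S (\<tau> n) u - u)"
    using \<tau>_ge[of 0]
  proof eventually_elim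
    case (elim n)
    show ?case
      unfolding S_abs[OF assms elim] using elim assms
      by (intro ell_dominated(2) diff_ell S_ell R_ell p_nonneg) auto
  qed
  show "(\<lambda>n. psum p X (S (\<tau> n) u - u)) \<longlonglongrightarrow> 0"
    using assms by (simp add: R_def)
qed (use assms in \<open>auto intro: abs_ell R_ell\<close>)

text \<open>Only linear operations and one absolute value occur on the right, so facts about minima
  reduce to \<open>R_abs\<close> and \<open>S_abs\<close>.\<close>

lemma min_eq: "(\<lambda>x. min (u x) (v x)) = (\<lambda>x. 1/2 * ((u + v) - (\<lambda>x. \<bar>(u - v) x\<bar>)) x)"
  for u v :: "'y \<Rightarrow> real"
  by (auto simp: fun_eq_iff min_def)

lemma R_min:
  assumes "u \<in> R" "v \<in> R"
  shows "(\<lambda>x. min (u x) (v x)) \<in> R"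
  unfolding min_eq[of u v] using assms by (intro R_scale R_diff R_abs R_add)

lemma S_min:
  assumes "u \<in> R" "v \<in> R" "0 \<le> t"
  shows "S t (\<lambda>x. min (u x) (v x)) = (\<lambda>x. min (S t u x) (S t v x))"
proof -
  have "S t (\<lambda>x. min (u x) (v x)) = (\<lambda>x. 1/2 * S t ((u + v) - (\<lambda>x. \<bar>(u - v) x\<bar>)) x)"
    unfolding min_eq[of u v] using assms by (intro S_scale R_ell R_diff R_abs R_add)
  also have "S t ((u + v) - (\<lambda>x. \<bar>(u - v) x\<bar>)) = S t (u + v) - S t (\<lambda>x. \<bar>(u - v) x\<bar>)"
    using assms by (intro S_diff R_ell R_diff R_abs R_add)
  also have "S t (\<lambda>x. \<bar>(u - v) x\<bar>) = (\<lambda>x. \<bar>S t (u - v) x\<bar>)"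
    using assms by (intro S_abs R_diff)
  also have "S t (u - v) = S t u - S t v"
    using assms by (intro S_diff R_ell)
  also have "S t (u + v) = S t u + S t v"
    using assms by (intro S_add R_ell)
  finally show ?thesis
    unfolding min_eq[of "S t u" "S t v"] .
qed

lemma R_closed:
  assumes u: "u \<in> ell p X" and approx: "\<And>\<epsilon>. 0 < \<epsilon> \<Longrightarrow> \<exists>v\<in>R. psum p X (v - u) < \<epsilon>"
  shows "u \<in> R"
proof -
  define C :: real where "C = 2 powr p"
  have C: "0 < C" by (simp add: C_def)
  have "(\<lambda>n. psum p X (S (\<tau> n) u - u)) \<longlonglongrightarrow> 0"
  proof (rule tendstoI)
    fix \<epsilon> :: real
    assume \<epsilon>: "0 < \<epsilon>"
    \<comment> \<open>Two uses of the quasi-triangle inequality give the bound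
      \<open>C * (\<delta> + C * (\<delta> + \<delta>))\<close>, which this choice makes equal to
      \<open>\<epsilon>\<close>.\<close>
    define \<delta> where "\<delta> = \<epsilon> / (C * (1 + 2 * C))"
    have \<delta>: "0 < \<delta>" using \<epsilon> C by (simp add: \<delta>_def)
    obtain v where v: "v \<in> R" "psum p X (v - u) < \<delta>"
      using approx[OF \<delta>] by blast
    have "\<forall>\<^sub>F n in sequentially. psum p X (S (\<tau> n) v - v) < \<delta>"
      using v(1) \<delta> by (intro order_tendstoD(2)[of _ 0]) (auto simp: R_def)
    then show "\<forall>\<^sub>F n in sequentially. dist (psum p X (S (\<tau> n) u - u)) 0 < \<epsilon>"
      using \<tau>_ge[of 0]
    proof eventually_elim
      case (elim n)
      note ells = u R_ell[OF v(1)] diff_ell S_ell[OF elim(2)] p_nonneg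
      have uv: "psum p X (u - v) = psum p X (v - u)"
        by (simp add: psum_def abs_minus_commute)
      have "S (\<tau> n) u - u = S (\<tau> n) (u - v) + ((S (\<tau> n) v - v) + (v - u))"
        using ells by (simp add: S_diff elim)
      then have "psum p X (S (\<tau> n) u - u) \<le>
          C * (psum p X (S (\<tau> n) (u - v)) + psum p X ((S (\<tau> n) v - v) + (v - u)))"
        unfolding C_def by (simp only:) (intro psum_add_le add_ell ells)
      also have "\<dots> \<le> C * (psum p X (u - v) + C * (psum p X (S (\<tau> n) v - v) + psum p X (v - u)))"
        using C unfolding C_def
        by (intro mult_left_mono add_mono S_contraction psum_add_le ells elim) auto
      also have "\<dots> < C * (\<delta> + C * (\<delta> + \<delta>))"
        using C elim v(2) uv by (intro mult_strict_left_mono add_strict_mono) auto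
      also have "\<dots> = C * (1 + 2 * C) * \<delta>"
        by (simp add: algebra_simps)
      also have "\<dots> = \<epsilon>"
        using C by (simp add: \<delta>_def)
      finally show ?case
        by (simp add: psum_nonneg)
    qed
  qed
  then show ?thesis using u by (simp add: R_def)
qed

text \<open>A minimiser of the norm among the non-negative \<open>f \<in> R\<close> with \<open>f x = 1\<close> is least, because
  \<open>R\<close> is a lattice; for the same reason a minimising sequence may be taken decreasing.\<close>

lemma least_element:
  assumes u: "u \<in> R" "\<And>y. 0 \<le> u y" "0 < u x"
  obtains e where "e \<in> R" "\<And>y. 0 \<le> e y" "e x = 1"
    "\<And>f y. f \<in> R \<Longrightarrow> (\<And>z. 0 \<le> f z) \<Longrightarrow> f x * e y \<le> f y"
proof -
  define A where "A = {f \<in> R. (\<forall>y. 0 \<le> f y) \<and> f x = 1}"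
  define m where "m = Inf (psum p X ` A)"
  \<comment> \<open>Rescaling \<open>u\<close> to value 1 at \<open>x\<close> shows that the
    minimisation is over a non-empty set.\<close>
  have "(\<lambda>y. (1 / u x) * u y) \<in> A"
    unfolding A_def using R_scale[OF u(1), of "1 / u x"] u by auto
  then have A_ne: "A \<noteq> {}" by blast
  have bdd: "bdd_below (psum p X ` A)"
    by (rule bdd_belowI[of _ 0]) (auto simp: psum_nonneg)
  have m_le: "m \<le> psum p X f" if "f \<in> A" for f
    unfolding m_def using bdd that by (intro cInf_lower) auto
  have A_min: "(\<lambda>y. min (f y) (g y)) \<in> A" if "f \<in> A" "g \<in> A" for f g
    using that by (auto simp: A_def R_min)
  have "\<exists>f\<in>A. psum p X f < m + 1 / Suc n" for n
  proof -
    have "Inf (psum p X ` A) < m + 1 / Suc n"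
      unfolding m_def by simp
    then show ?thesis
      using A_ne cInf_lessD[of "psum p X ` A"] by force
  qed
  then obtain f where f: "\<And>n. f n \<in> A" "\<And>n. psum p X (f n) < m + 1 / real (Suc n)"
    by metis
  \<comment> \<open>\<open>g n\<close> is the pointwise minimum of \<open>f 0\<close>, ...,
    \<open>f n\<close>: it stays in \<open>A\<close>, decreases with \<open>n\<close>, and inherits
    the norm bound of \<open>f n\<close>.\<close>
  define g where "g = rec_nat (f 0) (\<lambda>n h y. min (h y) (f (Suc n) y))"
  have g_0: "g 0 = f 0" and g_Suc: "g (Suc n) = (\<lambda>y. min (g n y) (f (Suc n) y))" for n
    by (simp_all add: g_def)
  have gA: "g n \<in> A" for n
    by (induction n) (auto simp: g_0 g_Suc f A_min)
  have g_le_f: "g n y \<le> f n y" for n y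
    by (cases n) (auto simp: g_0 g_Suc)
  have dec: "decseq (\<lambda>n. g n y)" for y
    by (rule decseq_SucI) (simp add: g_Suc)
  have g_nonneg: "0 \<le> g n y" for n y
    using gA[of n] by (simp add: A_def)
  have g_ell: "g n \<in> ell p X" for n
    using gA[of n] by (simp add: A_def R_ell)
  have f_ell: "f n \<in> ell p X" for n
    using f(1)[of n] by (simp add: A_def R_ell)
  have g_psum: "psum p X (g n) < m + 1 / Suc n" for n
  proof -
    have "psum p X (g n) \<le> psum p X (f n)"
      using g_le_f g_nonneg by (intro ell_dominated(2)[OF f_ell p_nonneg]) (auto intro: order_trans[OF _ abs_ge_self])
    then show ?thesis using f(2)[of n] by simp
  qed
  define e where "e y = lim (\<lambda>n. g n y)" for y
  have g_lim: "(\<lambda>n. g n y) \<longlonglongrightarrow> e y" for y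
  proof -
    obtain L where "(\<lambda>n. g n y) \<longlonglongrightarrow> L"
      using decseq_convergent[OF dec, of 0 y] g_nonneg by metis
    then show ?thesis
      unfolding e_def by (simp add: limI)
  qed
  have e_nonneg: "0 \<le> e y" for y
    using g_lim g_nonneg by (intro LIMSEQ_le_const[OF g_lim]) auto
  have e_le: "e y \<le> g n y" for n y
    using decseq_ge[OF dec g_lim] .
  have e_ell: "e \<in> ell p X"
    using e_nonneg e_le by (intro ell_dominated(1)[OF g_ell[of 0] p_nonneg]) (auto intro: order_trans[OF _ abs_ge_self])
  \<comment> \<open>By superadditivity the sum for \<open>g n - g k\<close> is at most the drop from
    \<open>g n\<close> to \<open>g k\<close>, and the latter has sum at least \<open>m\<close>.
    Fatou in \<open>k\<close> then upgrades pointwise to norm convergence, as needed for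
    \<open>R_closed\<close>.\<close>
  have diff: "psum p X (g n - e) \<le> 1 / Suc n" for n
  proof (rule psum_Fatou(2)[of "\<lambda>k. g n - g k"])
    show "(\<lambda>k. (g n - g k) y) \<longlonglongrightarrow> (g n - e) y" for y
      using g_lim by (auto intro!: tendsto_intros)
    show "\<forall>\<^sub>F k in sequentially. g n - g k \<in> ell p X \<and> psum p X (g n - g k) \<le> 1 / Suc n"
      using eventually_ge_at_top[of n]
    proof eventually_elim
      case (elim k)
      have "psum p X (g n - g k) + psum p X (g k) \<le> psum p X (g n)"
        using g_ell p_ge_1 g_nonneg decseqD[OF dec elim] by (intro psum_superadditive) auto
      then show ?case
        using g_psum[of n] m_le[OF gA[of k]] diff_ell g_ell by auto
    qed
  qed (rule p_pos)
  have eR: "e \<in> R"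
  proof (rule R_closed[OF e_ell])
    fix \<epsilon> :: real
    assume "0 < \<epsilon>"
    then obtain n where "1 / Suc n < \<epsilon>"
      using nat_approx_posE by blast
    then show "\<exists>v\<in>R. psum p X (v - e) < \<epsilon>"
      using diff[of n] gA[of n] by (intro bexI[of _ "g n"]) (auto simp: A_def)
  qed
  have e1: "e x = 1"
  proof (rule LIMSEQ_unique[OF g_lim])
    show "(\<lambda>n. g n x) \<longlonglongrightarrow> 1"
      using gA by (simp add: A_def)
  qed
  have e_psum: "psum p X e \<le> m"
  proof (rule field_le_epsilon)
    fix \<epsilon> :: real
    assume "0 < \<epsilon>"
    then obtain n where "1 / Suc n < \<epsilon>"
      using nat_approx_posE by blast
    moreover have "psum p X e \<le> psum p X (g n)"
      using e_le e_nonneg by (intro ell_dominated(2)[OF g_ell p_nonneg]) (auto intro: order_trans[OF _ abs_ge_self])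
    ultimately show "psum p X e \<le> m + \<epsilon>"
      using g_psum[of n] by simp
  qed
  have eA: "e \<in> A"
    using eR e_nonneg e1 by (simp add: A_def)
  have least: "f x * e y \<le> f y" if "f \<in> R" "\<And>z. 0 \<le> f z" for f y
  proof (cases "f x = 0")
    case True
    then show ?thesis using that by simp
  next
    case False
    then have fx: "0 < f x" using that(2)[of x] by simp
    define h where "h y = (1 / f x) * f y" for y
    have "h \<in> A"
      unfolding A_def h_def using R_scale[OF that(1), of "1 / f x"] that(2) fx by auto
    then have hA: "(\<lambda>y. min (e y) (h y)) \<in> A"
      using A_min eA by blast
    \<comment> \<open>The minimum is again in \<open>A\<close>, so its sum is at least
      \<open>m\<close> and hence at least that of \<open>e\<close>; a smaller function with no
      smaller sum is \<open>e\<close> itself.\<close>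
    have "e = (\<lambda>y. min (e y) (h y))"
    proof (rule eq_if_psum_ge[OF e_ell p_ge_1])
      show "psum p X e \<le> psum p X (\<lambda>y. min (e y) (h y))"
        using e_psum m_le[OF hA] by simp
    qed (use hA in \<open>auto simp: A_def\<close>)
    then have "e y \<le> h y"
      by (metis min.cobounded2)
    then show ?thesis
      using fx by (simp add: h_def field_simps)
  qed
  show thesis
    by (rule that[OF eR e_nonneg e1 least])
qed

section \<open>Invariance of recurrent vectors\<close>

lemma least_element_fixed:
  assumes e: "e \<in> R" "\<And>y. 0 \<le> e y" "e x = 1"
    and least: "\<And>f y. f \<in> R \<Longrightarrow> (\<And>z. 0 \<le> f z) \<Longrightarrow> f x * e y \<le> f y"
    and t: "0 \<le> t"
  shows "S t e = e"
proof -
  define c where "c s = S s e x" for s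
  have c_lim: "(\<lambda>n. c (\<tau> n)) \<longlonglongrightarrow> 1"
    unfolding c_def using R_pointwise[OF e(1), of x] e(3) by simp
  have Se_nonneg: "0 \<le> S s e y" if "0 \<le> s" for s y
    using that e by (simp add: S_nonneg R_ell)
  have c_e_le: "c s * e y \<le> S s e y" if "0 \<le> s" for s y
    unfolding c_def using that e Se_nonneg by (intro least R_S) auto
  have e_pos: "0 < psum p X e"
    using norm_powr_le_psum[OF R_ell[OF e(1)], of x] e(3) by simp
  \<comment> \<open>\<open>S s e\<close> dominates \<open>c s\<close> times \<open>e\<close> but has
    the same norm as \<open>e\<close>.\<close>
  have c_le_1: "c s \<le> 1" if s: "0 \<le> s" for s
  proof -
    have c0: "0 \<le> c s" using Se_nonneg s by (simp add: c_def)
    have "c s powr p * psum p X e = psum p X (\<lambda>y. c s * e y)"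
      using c0 by (intro psum_scaled(2)[symmetric] R_ell e) (auto simp: abs_mult)
    also have "\<dots> \<le> psum p X (S s e)"
      using c_e_le[OF s] Se_nonneg[OF s] c0 e
      by (intro ell_dominated(2) S_ell R_ell p_nonneg s) (auto simp: abs_mult)
    also have "\<dots> = psum p X e"
      using R_psum e s by simp
    finally have "c s powr p \<le> 1"
      using e_pos by simp
    then show ?thesis
      using c0 p_pos by (metis linorder_not_le powr_less_mono2 powr_one_eq_one zero_le_one)
  qed
  have fixed_if: "S s e = e" if s: "0 \<le> s" "c s = 1" for s
    by (rule eq_if_psum_ge[where X = X and p = p])
      (use s e c_e_le[OF s(1)] R_psum[OF e(1) s(1)] in \<open>auto intro: S_ell R_ell p_ge_1\<close>)
  have "((\<lambda>s. psum p X (S s e - e)) \<longlongrightarrow> 0) (at_right 0)"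
    by (intro S_continuous R_ell e)
  then have "\<forall>\<^sub>F s in at_right 0. psum p X (S s e - e) < (1/2) powr p"
    by (rule order_tendstoD) simp
  \<comment> \<open>The bound \<open>(1/2) powr p\<close> forces pointwise deviations below 1/2, to
    be set against \<open>c (\<tau> n) > 1/2\<close> further on.\<close>
  then obtain \<delta> where \<delta>: "0 < \<delta>" "\<And>s. 0 < s \<Longrightarrow> s < \<delta> \<Longrightarrow> psum p X (S s e - e) < (1/2) powr p"
    by (auto simp: eventually_at_right_field)
  have small: "S s e = e" if s: "0 < s" "s < \<delta>" for s
  proof -
    define r where "r = S s e - (\<lambda>y. c s * e y)"
    have rR: "r \<in> R"
      unfolding r_def using s e by (intro R_diff R_S R_scale) auto
    have r_nonneg: "0 \<le> r y" for y
      using c_e_le[of s y] s by (simp add: r_def)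
    have rx: "r x = 0"
      using e(3) by (simp add: r_def c_def)
    \<comment> \<open>Since \<open>r x = 0\<close>, subtracting the minimum from \<open>e\<close>
      leaves the value 1 at \<open>x\<close>; leastness makes the difference dominate
      \<open>e\<close>, so the minimum vanishes.\<close>
    have disj: "(\<lambda>y. min (e y) (r y)) = 0"
    proof
      fix y
      have "(e - (\<lambda>y. min (e y) (r y))) x * e y \<le> (e - (\<lambda>y. min (e y) (r y))) y"
        using e rR by (intro least R_diff R_min) auto
      then show "min (e y) (r y) = 0 y"
        using rx e(3) r_nonneg[of y] e(2)[of y] e(2)[of x]
        by (auto simp: min_def intro: antisym split: if_splits)
    qed
    have "\<forall>\<^sub>F n in sequentially. c (\<tau> n) \<le> c s"
    proof -
      have "\<forall>\<^sub>F n in sequentially. 1/2 < c (\<tau> n)"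
        by (rule order_tendstoD(1)[OF c_lim]) simp
      then show ?thesis
        using \<tau>_ge[of s]
      proof eventually_elim
        case (elim n)
        define s' where "s' = \<tau> n - s"
        have s': "0 \<le> s'" using elim by (simp add: s'_def)
        note ells = R_ell[OF e(1)] R_ell[OF rR] scale_ell diff_ell S_ell
        have \<tau>n: "S (\<tau> n) e = S s' (S s e)"
          using S_semigroup[of s' s e] s s' ells by (simp add: s'_def)
        also have "S s e = (\<lambda>y. c s * e y) + r"
          by (simp add: r_def)
        also have "S s' \<dots> = S s' (\<lambda>y. c s * e y) + S s' r"
          by (intro S_add s' ells)
        also have "S s' (\<lambda>y. c s * e y) = (\<lambda>y. c s * S s' e y)"
          by (intro S_scale s' ells)
        finally have split: "c (\<tau> n) = c s * c s' + S s' r x"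
          by (simp add: c_def)
        \<comment> \<open>\<open>S s'\<close> preserves minima on \<open>R\<close>, so the images of
          \<open>e\<close> and \<open>r\<close> stay disjoint and at \<open>x\<close> one of them
          must vanish.\<close>
        have "S s' (\<lambda>y. min (e y) (r y)) = (\<lambda>y. min (S s' e y) (S s' r y))"
          using S_min e rR s' by auto
        moreover have "S s' 0 = 0"
          using S_diff[OF s', of e e] ells by simp
        ultimately have "min (c s') (S s' r x) = 0"
          unfolding disj c_def by (metis zero_fun_apply)
        \<comment> \<open>Contraction carries the smallness of \<open>S s e - e\<close> over to time
          \<open>s'\<close>; at \<open>x\<close> it says that \<open>c s'\<close> is within 1/2 of
          \<open>c (\<tau> n)\<close>, which exceeds 1/2.\<close>
        moreover have "0 < c s'"
        proof -
          have "norm (S s' (S s e - e) x) powr p \<le> psum p X (S s' (S s e - e))"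
            using s by (intro norm_powr_le_psum ells s') auto
          also have "\<dots> \<le> psum p X (S s e - e)"
            using s by (intro S_contraction ells s') auto
          also have "\<dots> < (1/2) powr p"
            using \<delta>(2) s by simp
          finally have "\<bar>S s' (S s e - e) x\<bar> < 1/2"
            using powr_mono2[of p "1/2" "\<bar>S s' (S s e - e) x\<bar>"] p_pos by (simp only: real_norm_def) linarith
          moreover have "S s' (S s e - e) x = c (\<tau> n) - c s'"
            using s ells by (simp add: S_diff s' \<tau>n c_def)
          ultimately show ?thesis
            using elim by linarith
        qed
        ultimately have "S s' r x = 0"
          by (auto simp: min_def split: if_splits)
        then have "c (\<tau> n) = c s * c s'"
          using split by simp
        also have "\<dots> \<le> c s * 1"
          using c_le_1[OF s'] Se_nonneg[of s x] s by (intro mult_left_mono) (auto simp: c_def)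
        finally show ?case by simp
      qed
    qed
    then have "1 \<le> c s"
      by (intro tendsto_upperbound[OF c_lim]) auto
    then show ?thesis
      using fixed_if c_le_1 s by (simp add: antisym)
  qed
  have iter: "S (real k * s) e = e" if s: "0 < s" "s < \<delta>" for s and k :: nat
  proof (induction k)
    case 0
    \<comment> \<open>The value at time 0 is read off from a small positive time through the
      semigroup law.\<close>
    have "S 0 e = S 0 (S s e)"
      using small s by simp
    also have "\<dots> = S (0 + s) e"
      using S_semigroup[of 0 s e] s e by (simp add: R_ell)
    finally show ?case
      using small s by simp
  next
    case (Suc k)
    have "S (real (Suc k) * s) e = S (s + real k * s) e"
      by (simp add: algebra_simps)
    also have "\<dots> = S s (S (real k * s) e)"
      using s e by (intro S_semigroup R_ell) auto
    finally show ?case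
      using Suc small s by simp
  qed
  show ?thesis
  proof (cases "t = 0")
    case True
    then show ?thesis using iter[of "\<delta> / 2" 0] \<delta> by simp
  next
    case False
    then have t: "0 < t" using t by simp
    \<comment> \<open>\<open>k\<close> is chosen so large that \<open>t / k\<close> falls below
      \<open>\<delta>\<close>; then \<open>t\<close> consists of \<open>k\<close> small
      steps.\<close>
    obtain k :: nat where "t / \<delta> < k"
      using reals_Archimedean2 by blast
    then have k: "t < k * \<delta>" "0 < real k"
      using \<delta> t by (auto simp: field_simps intro: Nat.gr0I)
    then show ?thesis
      using iter[of "t / k" k] t by (simp add: field_simps)
  qed
qed

lemma nonneg_fixed:
  assumes f: "f \<in> R" "\<And>y. 0 \<le> f y" and t: "0 \<le> t"
  shows "S t f = f"
proof (rule eq_if_psum_ge[where X = X and p = p])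
  show "f x \<le> S t f x" for x
  proof (cases "f x = 0")
    case True
    then show ?thesis using f t by (simp add: S_nonneg R_ell)
  next
    case False
    then have fx: "0 < f x"
      using f(2)[of x] by simp
    obtain e where e: "e \<in> R" "\<And>y. 0 \<le> e y" "e x = 1"
      and least: "\<And>f y. f \<in> R \<Longrightarrow> (\<And>z. 0 \<le> f z) \<Longrightarrow> f x * e y \<le> f y"
      using least_element[OF f fx] by metis
    \<comment> \<open>Only the value at \<open>x\<close> is compared: there the fixed lower bound
      \<open>f x * e\<close> attains \<open>f x\<close>, because \<open>e x = 1\<close>.\<close>
    have "f x = S t (\<lambda>y. f x * e y) x"
      using least_element_fixed[OF e least t] e t by (simp add: S_scale R_ell)
    also have "\<dots> \<le> S t f x"
      using f e t least by (intro S_mono scale_ell R_ell) auto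
    finally show ?thesis .
  qed
qed (use f t R_psum[OF f(1) t] in \<open>auto intro: S_ell R_ell p_ge_1\<close>)

text \<open>Write \<open>f\<close> as \<open>(\<bar>f\<bar> + f) - \<bar>f\<bar>\<close>; both terms
  are non-negative and in \<open>R\<close>.\<close>

lemma R_fixed:
  assumes f: "f \<in> R" and t: "0 \<le> t"
  shows "S t f = f"
proof -
  have "(\<lambda>x. \<bar>f x\<bar>) + f \<in> R"
    using f by (intro R_add R_abs)
  then have "S t ((\<lambda>x. \<bar>f x\<bar>) + f) = (\<lambda>x. \<bar>f x\<bar>) + f"
    using t by (intro nonneg_fixed) auto
  moreover have "S t (\<lambda>x. \<bar>f x\<bar>) = (\<lambda>x. \<bar>f x\<bar>)"
    using f t by (intro nonneg_fixed R_abs) auto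
  ultimately show ?thesis
    using f t by (simp add: S_add R_ell R_abs)
qed

end

section \<open>Complex semigroups\<close>

lemma lp_eq_ell: "lp p X = ell p X"
  by (simp add: lp_def ell_def)

lemma lp_norm_eq_psum: "lp_norm p X f = psum p X f powr (1 / p)"
  by (simp add: lp_norm_def psum_def)

lemma lp_tendsto_iff_psum:
  assumes "0 < p"
  shows "lp_tendsto p X F g L \<longleftrightarrow> ((\<lambda>i. psum p X (F i - g)) \<longlongrightarrow> 0) L"
  unfolding lp_tendsto_def lp_norm_eq_psum
  using assms by (intro powr_tendsto_0_iff psum_nonneg) simp

lemma psum_cscale:
  "f \<in> ell p X \<Longrightarrow> psum p X (cscale c f) = norm c powr p * psum p X f"
  by (rule psum_scaled(2)) (auto simp: cscale_def norm_mult)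

lemma cscale_ell: "f \<in> ell p X \<Longrightarrow> cscale c f \<in> ell p X"
  by (rule psum_scaled(1)[where c = "norm c"]) (auto simp: cscale_def norm_mult)

lemma psum_contraction:
  assumes A: "lp_bounded_linear p X A" and norm: "lp_opnorm p X A \<le> 1" and p: "0 < p"
    and f: "f \<in> ell p X"
  shows "psum p X (A f) \<le> psum p X f"
proof -
  have Af: "A f \<in> ell p X"
    and scale: "A (cscale c f) = cscale c (A f)" for c
    using A f by (auto simp: lp_bounded_linear_def lp_eq_ell)
  obtain K where K: "\<And>f. f \<in> ell p X \<Longrightarrow> lp_norm p X (A f) \<le> K * lp_norm p X f"
    using A unfolding lp_bounded_linear_def lp_eq_ell by metis
  have unit: "lp_norm p X (A g) \<le> 1" if g: "g \<in> ell p X" "lp_norm p X g \<le> 1" for g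
  proof -
    \<comment> \<open>A real supremum bounds its set only if the set is bounded above; the constant
      \<open>K\<close> provides this for \<open>lp_opnorm\<close>.\<close>
    have "bdd_above ((\<lambda>f. lp_norm p X (A f)) ` {f \<in> lp p X. lp_norm p X f \<le> 1})"
    proof (rule bdd_aboveI2)
      fix h assume h: "h \<in> {f \<in> lp p X. lp_norm p X f \<le> 1}"
      have "lp_norm p X (A h) \<le> K * lp_norm p X h"
        using h K by (simp add: lp_eq_ell)
      also have "\<dots> \<le> \<bar>K\<bar> * 1"
        using h by (intro mult_mono) (auto simp: lp_norm_eq_psum)
      finally show "lp_norm p X (A h) \<le> \<bar>K\<bar>" by simp
    qed
    then have "lp_norm p X (A g) \<le> lp_opnorm p X A"
      unfolding lp_opnorm_def using g by (intro cSUP_upper) (auto simp: lp_eq_ell)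
    then show ?thesis using norm by simp
  qed
  show ?thesis
  proof (cases "psum p X f = 0")
    case True
    then have "f = 0"
      using f psum_le_0_imp_zero by force
    then have "A f = 0"
      using scale[of 0] by (simp add: cscale_def zero_fun_def)
    then show ?thesis by (simp add: psum_nonneg)
  next
    case False
    then have pos: "0 < psum p X f"
      using psum_nonneg[of p X f] by simp
    define n where "n = lp_norm p X f"
    have n: "0 < n" "n powr p = psum p X f"
      using pos p by (auto simp: n_def lp_norm_eq_psum powr_powr)
    \<comment> \<open>The scalar that brings \<open>f\<close> to norm one, so that
      \<open>unit\<close> applies.\<close>
    define c :: complex where "c = of_real (1 / n)"
    have c: "norm c powr p = 1 / psum p X f"
      using n by (simp add: c_def norm_divide powr_divide)
    have "psum p X (cscale c f) = 1"
      using f pos c by (simp add: psum_cscale)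
    then have "lp_norm p X (A (cscale c f)) \<le> 1"
      using f by (intro unit cscale_ell) (auto simp: lp_norm_eq_psum)
    then have "(psum p X (A f) / psum p X f) powr (1 / p) \<le> 1"
      using Af c by (simp add: lp_norm_eq_psum scale psum_cscale)
    then have "((psum p X (A f) / psum p X f) powr (1 / p)) powr p \<le> 1 powr p"
      using p by (intro powr_mono2) auto
    then have "psum p X (A f) / psum p X f \<le> 1"
      using p pos psum_nonneg[of p X "A f"] by (simp add: powr_powr)
    then show ?thesis using pos by simp
  qed
qed

locale positive_lp_semigroup =
  fixes X :: "'x set" and p :: real
    and T :: "real \<Rightarrow> ('x \<Rightarrow> complex) \<Rightarrow> 'x \<Rightarrow> complex"
  assumes p_ge_1: "1 \<le> p"
    and contr: "contraction_semigroup p X T"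
    and pos: "0 \<le> t \<Longrightarrow> lp_positive p X (T t)"
begin

lemma p_pos: "0 < p"
  using p_ge_1 by simp

lemma T_bounded_linear: "0 \<le> t \<Longrightarrow> lp_bounded_linear p X (T t)"
  using contr by (simp add: contraction_semigroup_def one_param_semigroup_def)

lemma T_ell: "0 \<le> t \<Longrightarrow> f \<in> ell p X \<Longrightarrow> T t f \<in> ell p X"
  and T_add: "0 \<le> t \<Longrightarrow> f \<in> ell p X \<Longrightarrow> g \<in> ell p X \<Longrightarrow> T t (f + g) = T t f + T t g"
  and T_cscale: "0 \<le> t \<Longrightarrow> f \<in> ell p X \<Longrightarrow> T t (cscale c f) = cscale c (T t f)"
  using T_bounded_linear[of t] by (simp_all add: lp_bounded_linear_def lp_eq_ell)

lemma T_0: "f \<in> ell p X \<Longrightarrow> T 0 f = f"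
  and T_semigroup: "0 \<le> s \<Longrightarrow> 0 \<le> t \<Longrightarrow> f \<in> ell p X \<Longrightarrow> T (s + t) f = T s (T t f)"
  using contr by (simp_all add: contraction_semigroup_def one_param_semigroup_def lp_eq_ell)

lemma T_contraction: "0 \<le> t \<Longrightarrow> f \<in> ell p X \<Longrightarrow> psum p X (T t f) \<le> psum p X f"
  using contr T_bounded_linear p_pos by (intro psum_contraction) (auto simp: contraction_semigroup_def)

lemma T_continuous_0:
  assumes "f \<in> ell p X"
  shows "((\<lambda>t. psum p X (T t f - f)) \<longlongrightarrow> 0) (at_right 0)"
proof -
  have "\<forall>f\<in>ell p X. \<forall>t\<ge>0. lp_tendsto p X (\<lambda>s. T s f) (T t f) (at t within {0..})"
    using contr unfolding contraction_semigroup_def one_param_semigroup_def lp_eq_ell by blast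
  then have "lp_tendsto p X (\<lambda>s. T s f) (T 0 f) (at 0 within {0..})"
    using assms by blast
  then have "((\<lambda>t. psum p X (T t f - f)) \<longlongrightarrow> 0) (at 0 within {0..})"
    using assms p_pos by (simp add: lp_tendsto_iff_psum T_0)
  then show ?thesis
    by (rule tendsto_within_subset) auto
qed

lemma T_diff:
  assumes "0 \<le> t" "f \<in> ell p X" "g \<in> ell p X"
  shows "T t (f - g) = T t f - T t g"
proof -
  have "f - g \<in> ell p X"
    using assms p_pos by (simp add: ell_diff)
  then have "T t ((f - g) + g) = T t (f - g) + T t g"
    using assms by (simp only: T_add)
  then show ?thesis by simp
qed

lemma T_cnj: "0 \<le> t \<Longrightarrow> f \<in> ell p X \<Longrightarrow> T t (\<lambda>x. cnj (f x)) = (\<lambda>x. cnj (T t f x))"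
  using pos[of t] by (simp add: lp_positive_def lp_eq_ell)

section \<open>Reduction to the action on real functions\<close>

definition S :: "real \<Rightarrow> ('x \<Rightarrow> real) \<Rightarrow> 'x \<Rightarrow> real" where
  "S t u = (\<lambda>x. Re (T t (\<lambda>x. of_real (u x)) x))"

lemma of_real_ell: "u \<in> ell p X \<Longrightarrow> (\<lambda>x. complex_of_real (u x)) \<in> ell p X"
  by (simp add: ell_def)

text \<open>A real function is its own conjugate, so its image is self-conjugate as well. Hence
  taking the real part in \<open>S\<close> loses nothing.\<close>

lemma T_of_real:
  assumes "0 \<le> t" "u \<in> ell p X"
  shows "T t (\<lambda>x. of_real (u x)) = (\<lambda>x. of_real (S t u x))"
proof
  fix x
  have "cnj (T t (\<lambda>x. of_real (u x)) x) = T t (\<lambda>x. of_real (u x)) x"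
    using fun_cong[OF T_cnj[OF assms(1) of_real_ell[OF assms(2)]], of x] by simp
  then show "T t (\<lambda>x. of_real (u x)) x = of_real (S t u x)"
    by (simp add: S_def complex_eq_iff)
qed

lemma psum_of_real: "psum p X (\<lambda>x. complex_of_real (u x)) = psum p X u"
  by (simp add: psum_def)

lemma of_real_ell_iff: "(\<lambda>x. complex_of_real (u x)) \<in> ell p X \<longleftrightarrow> u \<in> ell p X"
  by (simp add: ell_def)

lemma real_lp_semigroup: "real_lp_semigroup X p S"
proof
  show "1 \<le> p" by (rule p_ge_1)
next
  fix t :: real and u :: "'x \<Rightarrow> real"
  assume tu: "0 \<le> t" "u \<in> ell p X"
  have "(\<lambda>x. complex_of_real (S t u x)) \<in> ell p X"
    unfolding T_of_real[OF tu, symmetric] using tu by (intro T_ell of_real_ell)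
  then show "S t u \<in> ell p X" by (simp only: of_real_ell_iff)
  show "S t (\<lambda>x. c * u x) = (\<lambda>x. c * S t u x)" for c
    using T_cscale[OF tu(1) of_real_ell[OF tu(2)], of "of_real c"]
    by (simp add: S_def cscale_def)
  show "0 \<le> S t u x" if "\<And>x. 0 \<le> u x" for x
  \<comment> \<open>Positivity of \<open>T t\<close> constrains values on \<open>X\<close> only;
    elsewhere the value is zero.\<close>
  proof (cases "x \<in> X")
    case True
    then have "T t (\<lambda>x. of_real (u x)) x \<in> \<real>\<^sub>\<ge>\<^sub>0"
      using pos[OF tu(1)] of_real_ell[OF tu(2)] that
      by (auto simp: lp_positive_def lp_eq_ell)
    then show ?thesis
      by (auto simp: S_def complex_nonneg_Reals_iff)
  next
    case False
    then show ?thesis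
      using ell_outside[OF \<open>S t u \<in> ell p X\<close>] by simp
  qed
  show "psum p X (S t u) \<le> psum p X u"
    using T_contraction[OF tu(1) of_real_ell[OF tu(2)]]
    unfolding T_of_real[OF tu] psum_of_real .
  show "S t (u + v) = S t u + S t v" if "v \<in> ell p X" for v
    using T_add[OF tu(1) of_real_ell[OF tu(2)] of_real_ell[OF that]]
    by (simp add: S_def plus_fun_def fun_eq_iff)
  show "S (s + t) u = S s (S t u)" if "0 \<le> s" for s
    unfolding S_def[of "s + t"] T_semigroup[OF that tu(1) of_real_ell[OF tu(2)]] T_of_real[OF tu]
    by (simp add: S_def)
next
  fix u :: "'x \<Rightarrow> real"
  assume u: "u \<in> ell p X"
  have eq: "psum p X (T t (\<lambda>x. of_real (u x)) - (\<lambda>x. of_real (u x))) = psum p X (S t u - u)"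
    if "0 < t" for t
    using psum_of_real[of "S t u - u"] T_of_real[OF _ u, of t] that by (simp add: fun_diff_def)
  have ev: "\<forall>\<^sub>F t in at_right 0.
      psum p X (T t (\<lambda>x. of_real (u x)) - (\<lambda>x. of_real (u x))) = psum p X (S t u - u)"
    using eventually_at_right_less[of "0::real"] by eventually_elim (rule eq)
  show "((\<lambda>t. psum p X (S t u - u)) \<longlongrightarrow> 0) (at_right 0)"
    by (rule Lim_transform_eventually[OF T_continuous_0[OF of_real_ell[OF u]] ev])
qed

text \<open>The sequence is arbitrary because two are used: the given one, and the multiples of the
  period of an eigenvector.\<close>

lemma real_recurrence_fixed:
  assumes "filterlim \<tau> at_top sequentially" "u \<in> ell p X"
    and "(\<lambda>n. psum p X (S (\<tau> n) u - u)) \<longlonglongrightarrow> 0" "0 \<le> t"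
  shows "S t u = u"
proof -
  interpret real_lp_recurrence X p S \<tau>
    using real_lp_semigroup assms(1)
    by (simp add: real_lp_recurrence_def real_lp_recurrence_axioms_def)
  show ?thesis
    using assms by (intro R_fixed) (auto simp: R_def)
qed

lemma real_recurrent_subspace_fixed:
  assumes \<tau>: "filterlim \<tau> at_top sequentially"
    and f: "f \<in> real_recurrent_subspace p X T \<tau>" and t: "0 \<le> t"
  shows "T t f = f"
proof -
  have f_ell: "f \<in> ell p X" and lim: "(\<lambda>n. psum p X (T (\<tau> n) f - f)) \<longlonglongrightarrow> 0"
    using f p_pos
    by (auto simp: real_recurrent_subspace_def recurrent_subspace_def lp_eq_ell lp_tendsto_iff_psum)
  define u where "u x = Re (f x)" for x
  have f_eq: "f = (\<lambda>x. of_real (u x))"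
  proof
    fix x
    show "f x = of_real (u x)"
      using f f_ell by (cases "x \<in> X") (auto simp: real_recurrent_subspace_def u_def ell_outside)
  qed
  have u: "u \<in> ell p X"
    using f_ell unfolding f_eq of_real_ell_iff .
  have "\<forall>\<^sub>F n in sequentially. psum p X (T (\<tau> n) f - f) = psum p X (S (\<tau> n) u - u)"
  proof -
    have "\<forall>\<^sub>F n in sequentially. 0 \<le> \<tau> n"
      using \<tau> by (simp add: filterlim_at_top)
    then show ?thesis
    proof eventually_elim
      case (elim n)
      show ?case
        using psum_of_real[of "S (\<tau> n) u - u"]
        unfolding f_eq T_of_real[OF elim u] by (simp add: fun_diff_def)
    qed
  qed
  then have "(\<lambda>n. psum p X (S (\<tau> n) u - u)) \<longlonglongrightarrow> 0"
    by (rule Lim_transform_eventually[OF lim])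
  then have "S t u = u"
    by (rule real_recurrence_fixed[OF \<tau> u _ t])
  then show ?thesis
    unfolding f_eq T_of_real[OF t u] by simp
qed

text \<open>By \<open>T_of_real\<close> the images of the real and imaginary parts of
  \<open>f\<close> are real, so they are the two parts of \<open>T t f\<close>.\<close>

lemma S_Re_Im:
  assumes "0 \<le> t" "f \<in> ell p X"
  shows "S t (\<lambda>x. Re (f x)) = (\<lambda>x. Re (T t f x))" and "S t (\<lambda>x. Im (f x)) = (\<lambda>x. Im (T t f x))"
    and "(\<lambda>x. Re (f x)) \<in> ell p X" and "(\<lambda>x. Im (f x)) \<in> ell p X"
proof -
  show Re: "(\<lambda>x. Re (f x)) \<in> ell p X" and Im: "(\<lambda>x. Im (f x)) \<in> ell p X"
    using p_pos by (auto intro!: ell_dominated(1)[OF assms(2)] abs_Re_le_cmod abs_Im_le_cmod)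
  have "f = (\<lambda>x. of_real (Re (f x))) + cscale \<i> (\<lambda>x. of_real (Im (f x)))"
    by (simp add: fun_eq_iff cscale_def complex_eq_iff)
  then have "T t f = T t ((\<lambda>x. of_real (Re (f x))) + cscale \<i> (\<lambda>x. of_real (Im (f x))))"
    by (rule arg_cong)
  also have "\<dots> = (\<lambda>x. of_real (S t (\<lambda>x. Re (f x)) x)) + cscale \<i> (\<lambda>x. of_real (S t (\<lambda>x. Im (f x)) x))"
    using assms Re Im by (simp add: T_add T_cscale cscale_ell of_real_ell T_of_real)
  finally have "T t f x = of_real (S t (\<lambda>x. Re (f x)) x) + \<i> * of_real (S t (\<lambda>x. Im (f x)) x)" for x
    by (simp add: cscale_def)
  then show "S t (\<lambda>x. Re (f x)) = (\<lambda>x. Re (T t f x))" "S t (\<lambda>x. Im (f x)) = (\<lambda>x. Im (T t f x))"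
    by auto
qed

section \<open>Generator, eigenvectors and point spectrum\<close>

lemma generator_unique:
  assumes f: "f \<in> ell p X" and g: "g \<in> ell p X" "h \<in> ell p X"
    and "lp_tendsto p X (\<lambda>h. cscale (of_real (1 / h)) (T h f - f)) g (at_right 0)"
    and "lp_tendsto p X (\<lambda>h. cscale (of_real (1 / h)) (T h f - f)) h (at_right 0)"
  shows "g = h"
proof
  fix x
  have "((\<lambda>h. cscale (of_real (1 / h)) (T h f - f) x) \<longlongrightarrow> l x) (at_right 0)"
    if "l \<in> ell p X"
      "lp_tendsto p X (\<lambda>h. cscale (of_real (1 / h)) (T h f - f)) l (at_right 0)" for l
  proof (rule psum_tendsto_pointwise[where F = "\<lambda>h. cscale (of_real (1 / h)) (T h f - f)"])
    show "((\<lambda>h. psum p X (cscale (of_real (1 / h)) (T h f - f) - l)) \<longlongrightarrow> 0) (at_right 0)"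
      using that p_pos by (simp add: lp_tendsto_iff_psum)
    show "\<forall>\<^sub>F h in at_right 0. cscale (of_real (1 / h)) (T h f - f) - l \<in> ell p X"
      using eventually_at_right_less[of "0::real"]
      by eventually_elim (use that p_pos f in \<open>auto intro!: ell_diff cscale_ell T_ell\<close>)
  qed (rule p_pos)
  from this[OF g(1) assms(4)] this[OF g(2) assms(5)] show "g x = h x"
    by (rule tendsto_unique[OF trivial_limit_at_right_real])
qed

text \<open>Replaces the definite description in \<open>generator\<close> by the limit it stands
  for, which \<open>generator_unique\<close> justifies.\<close>

lemma peripheral_eigenspace_iff:
  "f \<in> peripheral_eigenspace p X T \<theta> \<longleftrightarrow> f \<in> ell p X \<and>
    lp_tendsto p X (\<lambda>h. cscale (of_real (1 / h)) (T h f - f)) (cscale (\<i> * of_real \<theta>) f) (at_right 0)"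
    (is "_ \<longleftrightarrow> _ \<and> ?lim (cscale (\<i> * of_real \<theta>) f)")
proof -
  have gen: "generator p X T f = g" if "f \<in> ell p X" "g \<in> ell p X" "?lim g" for g
    unfolding generator_def lp_eq_ell
    by (rule the_equality) (use that generator_unique in blast)+
  show ?thesis
    unfolding peripheral_eigenspace_def generator_dom_def lp_eq_ell
    using gen cscale_ell by fastforce
qed

text \<open>The spectrum asks for an eigenspace different from \<open>{0}\<close>, which an empty
  set would satisfy too. Membership of 0 turns this into the existence of a non-zero
  eigenvector.\<close>

lemma zero_in_peripheral_eigenspace: "0 \<in> peripheral_eigenspace p X T \<theta>"
proof -
  have z: "0 \<in> ell p X" "cscale c 0 = 0" for c
    by (auto simp: ell_def cscale_def fun_eq_iff)
  have "T h 0 = 0" if "0 \<le> h" for h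
    using T_diff[OF that, of 0 0] z by simp
  then have "\<forall>\<^sub>F h in at_right 0. 0 = psum p X (cscale (of_real (1 / h)) (T h 0 - 0) - cscale (\<i> * of_real \<theta>) 0)"
    using eventually_at_right_less[of "0::real"]
    by (auto elim!: eventually_mono simp: z simp del: of_real_divide)
  then show ?thesis
    unfolding peripheral_eigenspace_iff lp_tendsto_iff_psum[OF p_pos]
    by (intro conjI z Lim_transform_eventually[OF tendsto_const])
qed

text \<open>With \<open>V t = cis (- \<theta> * t) T t\<close> one has \<open>\<parallel>V t f - f\<parallel> \<le> n \<parallel>V (t / n) f - f\<parallel>\<close>, and the right-hand
  side tends to zero because the right derivative of \<open>V t f\<close> at \<open>t = 0\<close> vanishes.\<close>

lemma eigenvector_semigroup:
  assumes "f \<in> peripheral_eigenspace p X T \<theta>" and t: "0 \<le> t"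
  shows "T t f = cscale (cis (\<theta> * t)) f"
proof -
  have f: "f \<in> ell p X" and lim: "((\<lambda>h. psum p X (cscale (of_real (1 / h)) (T h f - f)
      - cscale (\<i> * of_real \<theta>) f)) \<longlongrightarrow> 0) (at_right 0)"
    using assms p_pos by (auto simp: peripheral_eigenspace_iff lp_tendsto_iff_psum)
  \<comment> \<open>The error of the difference quotient of \<open>cis (\<theta> * h)\<close> at 0
    against its derivative.\<close>
  define b where "b h = \<i> * of_real \<theta> - (cis (\<theta> * h) - 1) / of_real h" for h
  have b_lim: "(b \<longlongrightarrow> 0) (at_right 0)"
  proof -
    have "((\<lambda>z. exp (\<i> * of_real \<theta> * z)) has_field_derivative \<i> * of_real \<theta>) (at 0)"
      by (auto intro!: derivative_eq_intros)
    then have "((\<lambda>z. (exp (\<i> * of_real \<theta> * z) - 1) / z) \<longlongrightarrow> \<i> * of_real \<theta>) (at 0)"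
      by (simp add: has_field_derivative_iff)
    moreover have "filterlim complex_of_real (at 0) (at_right 0)"
      unfolding filterlim_at
      by (auto intro!: tendsto_eq_intros simp: eventually_at_filter)
    ultimately have "((\<lambda>h. (exp (\<i> * of_real \<theta> * of_real h) - 1) / of_real h) \<longlongrightarrow> \<i> * of_real \<theta>)
        (at_right (0::real))"
      by (rule filterlim_compose)
    then have "((\<lambda>h. (cis (\<theta> * h) - 1) / of_real h) \<longlongrightarrow> \<i> * of_real \<theta>) (at_right (0::real))"
      by (simp add: cis_conv_exp mult.assoc)
    then show ?thesis
      unfolding b_def by (auto intro: tendsto_eq_intros)
  qed
  \<comment> \<open>The difference quotient at 0 of the rotated orbit.\<close>
  define W where "W h = cscale (of_real (1 / h)) (cscale (cis (- \<theta> * h)) (T h f) - f)" for h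
  have W_ell: "W h \<in> ell p X" if "0 \<le> h" for h
    unfolding W_def using that f p_pos by (intro cscale_ell ell_diff T_ell) auto
  define G where "G h = 2 powr p * (psum p X (cscale (of_real (1 / h)) (T h f - f)
      - cscale (\<i> * of_real \<theta>) f) + norm (b h) powr p * psum p X f)" for h
  have G_lim: "(G \<longlongrightarrow> 0) (at_right 0)"
  proof -
    have "((\<lambda>h. norm (b h) powr p) \<longlongrightarrow> 0) (at_right 0)"
      using b_lim p_pos by (simp add: powr_tendsto_0_iff tendsto_norm_zero)
    then show ?thesis
      unfolding G_def by (intro tendsto_mult_right_zero tendsto_add_zero lim tendsto_mult_left_zero)
  qed
  have W_le: "psum p X (W h) \<le> G h" if h: "0 < h" for h
    unfolding G_def psum_cscale[OF f, symmetric]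
  proof (rule ell_dominated_add(2))
    fix x
    let ?d = "cscale (of_real (1 / h)) (T h f - f) - cscale (\<i> * of_real \<theta>) f"
    \<comment> \<open>Multiplying \<open>W h\<close> by the unimodular
      \<open>cis (\<theta> * h)\<close> keeps its modulus and splits it into the generator error
      plus \<open>b h\<close> times \<open>f\<close>.\<close>
    have *: "a * (k * (a' * u - v)) = k * (u - v) - i * v + (i - (a - 1) * k) * v"
      if "a * a' = 1" for a a' k u v i :: complex
      using that by algebra
    have "cis (\<theta> * h) * W h x = ?d x + cscale (b h) f x"
      using *[of "cis (\<theta> * h)" "cis (- \<theta> * h)" "of_real (1 / h)"]
      by (simp add: W_def cscale_def b_def cis_mult)
    then have "norm (W h x) = norm (?d x + cscale (b h) f x)"
      by (metis mult_1 norm_cis norm_mult[of "cis (\<theta> * h)" "W h x"])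
    then show "norm (W h x) \<le> norm (?d x) + norm (cscale (b h) f x)"
      by (simp only: norm_triangle_ineq)
  qed (use h f p_pos in \<open>auto intro!: ell_diff cscale_ell T_ell\<close>)
  have W_lim: "((\<lambda>h. psum p X (W h) powr (1 / p)) \<longlongrightarrow> 0) (at_right 0)"
  proof -
    have "\<forall>\<^sub>F h in at_right 0. psum p X (W h) \<le> G h"
      using eventually_at_right_less[of "0::real"] by eventually_elim (rule W_le)
    then have "((\<lambda>h. psum p X (W h)) \<longlongrightarrow> 0) (at_right 0)"
      by (rule tendsto_sandwich[OF _ _ tendsto_const G_lim, rotated]) (simp add: psum_nonneg)
    then show ?thesis
      using p_pos by (simp add: powr_tendsto_0_iff psum_nonneg)
  qed
  have "cis (- \<theta> * t) * T t f x = f x" for x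
  proof -
    \<comment> \<open>At a fixed point \<open>x\<close> the increments are complex numbers, so the
      ordinary triangle inequality is available.\<close>
    define \<phi> where "\<phi> s = cis (- \<theta> * s) * T s f x" for s
    have step: "norm (\<phi> (s + h) - \<phi> s) \<le> h * psum p X (W h) powr (1 / p)"
      if s: "0 \<le> s" and h: "0 < h" for s h
    proof -
      have eq: "cscale (cis (- \<theta> * h)) (T h f) - f = cscale (of_real h) (W h)"
        using h by (simp add: W_def cscale_def fun_eq_iff)
      have "\<phi> (s + h) - \<phi> s = cis (- \<theta> * s) * (cis (- \<theta> * h) * T s (T h f) x - T s f x)"
      proof -
        have "cis (- \<theta> * (s + h)) = cis (- \<theta> * s) * cis (- \<theta> * h)"
          by (simp only: cis_mult ring_distribs)
        then show ?thesis
          using T_semigroup[OF s _ f, of h] h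
          by (simp only: \<phi>_def right_diff_distrib mult.assoc less_imp_le)
      qed
      also have "cis (- \<theta> * h) * T s (T h f) x - T s f x = T s (cscale (cis (- \<theta> * h)) (T h f) - f) x"
        using s h f by (simp add: T_diff T_cscale T_ell cscale_ell) (simp add: cscale_def)
      also have "\<dots> = of_real h * T s (W h) x"
        unfolding eq using s h by (simp add: T_cscale W_ell) (simp add: cscale_def)
      finally have "norm (\<phi> (s + h) - \<phi> s) = h * norm (T s (W h) x)"
        using h by (simp add: norm_mult)
      also have "norm (T s (W h) x) = (norm (T s (W h) x) powr p) powr (1 / p)"
        using p_pos by (simp add: powr_powr)
      also have "\<dots> \<le> psum p X (W h) powr (1 / p)"
        using s h p_pos W_ell[of h]
        by (intro powr_mono2 order_trans[OF norm_powr_le_psum T_contraction]) (auto intro: T_ell)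
      finally show ?thesis
        using h by (simp add: mult_left_mono)
    qed
    \<comment> \<open>Telescoping over \<open>k\<close> steps of length \<open>h\<close>. With
      \<open>h = t / k\<close> the factor \<open>k * h\<close> stays equal to \<open>t\<close> while
      \<open>psum p X (W h)\<close> tends to zero.\<close>
    have tele: "norm (\<phi> (real k * h) - \<phi> 0) \<le> real k * (h * psum p X (W h) powr (1 / p))"
      if h: "0 < h" for h k
    proof (induction k)
      case (Suc k)
      have "real (Suc k) * h = real k * h + h"
        by (simp add: algebra_simps)
      then have "\<phi> (real (Suc k) * h) - \<phi> 0 = (\<phi> (real k * h + h) - \<phi> (real k * h)) + (\<phi> (real k * h) - \<phi> 0)"
        by simp
      also have "norm \<dots> \<le> h * psum p X (W h) powr (1 / p) + real k * (h * psum p X (W h) powr (1 / p))"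
        using h by (intro norm_triangle_le add_mono step Suc) auto
      finally show ?case
        by (simp add: algebra_simps)
    qed simp
    have "\<phi> t = \<phi> 0"
    proof (cases "t = 0")
      case False
      then have t: "0 < t" using t by simp
      have "filterlim (\<lambda>n. t / real (Suc n)) (at_right 0) sequentially"
        unfolding filterlim_at
      proof
        have "(\<lambda>n. t * (1 / real (Suc n))) \<longlonglongrightarrow> 0"
          using LIMSEQ_inverse_real_of_nat
          by (intro tendsto_mult_right_zero) (simp add: inverse_eq_divide)
        then show "(\<lambda>n. t / real (Suc n)) \<longlonglongrightarrow> 0" by simp
      qed (use t in auto)
      then have "(\<lambda>n. t * psum p X (W (t / real (Suc n))) powr (1 / p)) \<longlonglongrightarrow> 0"
        by (intro tendsto_mult_right_zero filterlim_compose[OF W_lim])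
      moreover have "norm (\<phi> t - \<phi> 0) \<le> t * psum p X (W (t / real (Suc n))) powr (1 / p)" for n
        using tele[of "t / real (Suc n)" "Suc n"] t by simp
      ultimately have "norm (\<phi> t - \<phi> 0) \<le> 0"
        by (intro LIMSEQ_le_const) auto
      then show ?thesis by simp
    qed simp
    then show ?thesis
      using f by (simp add: \<phi>_def T_0)
  qed
  then have "cis (\<theta> * t) * (cis (- \<theta> * t) * T t f x) = cis (\<theta> * t) * f x" for x
    by simp
  then show ?thesis
    by (simp add: cscale_def fun_eq_iff cis_mult flip: mult.assoc)
qed

lemma peripheral_point_spectrum_trivial: "peripheral_point_spectrum p X T \<subseteq> {0}"
proof
  fix \<theta>
  assume "\<theta> \<in> peripheral_point_spectrum p X T"
  then obtain f where f: "f \<in> peripheral_eigenspace p X T \<theta>" "f \<noteq> 0"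
    using zero_in_peripheral_eigenspace[of \<theta>] by (auto simp: peripheral_point_spectrum_def)
  have f_ell: "f \<in> ell p X"
    using f by (simp add: peripheral_eigenspace_iff)
  show "\<theta> \<in> {0}"
  proof (rule ccontr)
    assume "\<theta> \<notin> {0}"
    then have \<theta>: "\<theta> \<noteq> 0" by simp
    \<comment> \<open>Multiples of the period of the eigenvector, at which it returns exactly; the
      absolute value keeps the times non-negative.\<close>
    define \<tau> where "\<tau> n = 2 * pi / \<bar>\<theta>\<bar> * real n" for n
    have \<tau>: "filterlim \<tau> at_top sequentially"
      unfolding \<tau>_def using \<theta>
      by (intro filterlim_tendsto_pos_mult_at_top[OF tendsto_const] filterlim_real_sequentially) auto
    have \<tau>_nonneg: "0 \<le> \<tau> n" for n
      by (simp add: \<tau>_def)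
    have "cis (\<theta> * \<tau> n) = 1" for n
    proof -
      \<comment> \<open>The sign of \<open>\<theta>\<close> is absorbed into the integer multiple of
        \<open>2 * pi\<close>.\<close>
      have "\<theta> * \<tau> n = 2 * pi * (of_int (sgn_int * int n))" if "sgn_int = (if \<theta> < 0 then -1 else 1)" for sgn_int
        using \<theta> that by (auto simp: \<tau>_def)
      then show ?thesis
        by (metis cis_multiple_2pi Ints_of_int)
    qed
    then have T\<tau>: "T (\<tau> n) f = f" for n
      using eigenvector_semigroup[OF f(1) \<tau>_nonneg] by (simp add: cscale_def)
    \<comment> \<open>Half a period: the eigenvector is fixed by recurrence but also multiplied by
      -1.\<close>
    define t where "t = pi / \<bar>\<theta>\<bar>"
    have t: "0 \<le> t" by (simp add: t_def)
    have "S t (\<lambda>x. Re (f x)) = (\<lambda>x. Re (f x))"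
      by (rule real_recurrence_fixed[OF \<tau> S_Re_Im(3)[OF t f_ell] _ t])
        (simp add: S_Re_Im(1)[OF \<tau>_nonneg f_ell] T\<tau>)
    moreover have "S t (\<lambda>x. Im (f x)) = (\<lambda>x. Im (f x))"
      by (rule real_recurrence_fixed[OF \<tau> S_Re_Im(4)[OF t f_ell] _ t])
        (simp add: S_Re_Im(2)[OF \<tau>_nonneg f_ell] T\<tau>)
    ultimately have "T t f = f"
      unfolding S_Re_Im(1,2)[OF t f_ell] by (auto simp: fun_eq_iff complex_eq_iff)
    moreover have "cis (\<theta> * t) = -1"
      using \<theta> by (cases "\<theta> < 0") (auto simp: t_def complex_eq_iff)
    ultimately have "f = cscale (-1) f"
      using eigenvector_semigroup[OF f(1) t] by simp
    then have "f = 0"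
      by (auto simp: cscale_def fun_eq_iff)
    then show False using f(2) by simp
  qed
qed

end

theorem theorem9:
  fixes X :: "'x set" and p :: real
    and T :: "real \<Rightarrow> ('x \<Rightarrow> complex) \<Rightarrow> 'x \<Rightarrow> complex"
  assumes "countable X"
    and "1 \<le> p"
    and "contraction_semigroup p X T"
    and "\<And>t. 0 \<le> t \<Longrightarrow> lp_positive p X (T t)"
  shows "(\<forall>\<tau> :: nat \<Rightarrow> real.
            filterlim \<tau> at_top sequentially \<longrightarrow>
            (\<forall>f \<in> peripheral_span p X T. lp_tendsto p X (\<lambda>n. T (\<tau> n) f) f sequentially) \<longrightarrow>
            (\<forall>t\<ge>0. \<forall>f \<in> real_recurrent_subspace p X T \<tau>. T t f = f))
         \<and> peripheral_point_spectrum p X T \<subseteq> {0}"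
proof -
  interpret positive_lp_semigroup X p T
    using assms(2-4) by unfold_locales
  show ?thesis
    using real_recurrent_subspace_fixed peripheral_point_spectrum_trivial by blast
qed

end
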